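(* There is an absolute constant $c>0$ such that for all sufficiently large integers $N$ and all $2\le q\le\infty$, if $A\in\mathbb{R}^{N\times N}$ is a random matrix with independent standard normal entries, then $$\frac{\mathbb{E}[\operatorname{disc}_q(A)]}{\sqrt{\operatorname{Var}(\operatorname{disc}_q(A))}}\ \ge\ c\,N^{\frac1q}\sqrt{1+\left(\frac12-\frac1q\right)\log N}.$$
   Context: For an $M\times N$ matrix $A$, the $\ell^q$ discrepancy is $$\operatorname{disc}_q(A):=\min_{\sigma\in\{-1,+1\}^N}\|A\sigma\|_q .$$ Convention: $1/q=0$ when $q=\infty$. *)

theory Defs
  imports "HOL-Probability.Probability" "Jordan_Normal_Form.Matrix"
begin

unbundle no vec_syntax
hide_const (open) Finite_Cartesian_Product.vec Finite_Cartesian_Product.mat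

(* The exponent q ranges over extended reals so that q = \<infinity> is allowed. The inserted 0 only
   matters for the zero-dimensional vector, where it makes the sup norm equal to 0. *)
definition lq_norm :: "ereal \<Rightarrow> real vec \<Rightarrow> real" where
  "lq_norm q v =
     (if q = \<infinity> then Max (insert 0 {\<bar>v $ i\<bar> | i. i < dim_vec v})
      else (\<Sum>i<dim_vec v. \<bar>v $ i\<bar> powr real_of_ereal q) powr (1 / real_of_ereal q))"

definition sign_vecs :: "nat \<Rightarrow> real vec set" where
  "sign_vecs N = {\<sigma> \<in> carrier_vec N. \<forall>j<N. \<sigma> $ j \<in> {-1, 1}}"

definition disc :: "ereal \<Rightarrow> real mat \<Rightarrow> real" where
  "disc q A = Min ((\<lambda>\<sigma>. lq_norm q (A *\<^sub>v \<sigma>)) ` sign_vecs (dim_col A))"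

(* The type real mat carries no sigma-algebra, so the random matrix is realised as the function
   gaussian_mat N on the probability space gaussian_entries N, whose coordinates are independent
   standard normal variables. Lemma distr_gaussian_entries shows that this is no restriction: any
   family of N * N independent standard normals, on any probability space, has this joint law. *)
definition gaussian_entries :: "nat \<Rightarrow> (nat \<times> nat \<Rightarrow> real) measure" where
  "gaussian_entries N =
     (\<Pi>\<^sub>M p \<in> {..<N} \<times> {..<N}. density lborel (\<lambda>x. ennreal (std_normal_density x)))"

definition gaussian_mat :: "nat \<Rightarrow> (nat \<times> nat \<Rightarrow> real) \<Rightarrow> real mat" where
  "gaussian_mat N \<omega> = Matrix.mat N N \<omega>"

lemma finite_sign_vecs: "finite (sign_vecs N)"
proof -
  have "sign_vecs N \<subseteq> (\<lambda>f. Matrix.vec N f) ` ({..<N} \<rightarrow>\<^sub>E {-1, 1})"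
  proof
    fix s assume s: "s \<in> sign_vecs N"
    let ?f = "\<lambda>j\<in>{..<N}. s $ j"
    have "s = Matrix.vec N ?f" "?f \<in> {..<N} \<rightarrow>\<^sub>E {-1, 1}"
      using s by (auto simp: sign_vecs_def)
    then show "s \<in> (\<lambda>f. Matrix.vec N f) ` ({..<N} \<rightarrow>\<^sub>E {-1, 1})" by blast
  qed
  then show ?thesis by (rule finite_subset) (auto intro!: finite_imageI finite_PiE)
qed

lemma sign_vecs_nonempty: "sign_vecs N \<noteq> {}"
proof -
  have "Matrix.vec N (\<lambda>_. 1) \<in> sign_vecs N" by (auto simp: sign_vecs_def)
  then show ?thesis by blast
qed

lemma prob_space_gaussian_entries: "prob_space (gaussian_entries N)"
  unfolding gaussian_entries_def
  by (intro prob_space_PiM prob_space_normal_density) simp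

lemma (in prob_space) distr_gaussian_entries:
  fixes X :: "nat \<times> nat \<Rightarrow> 'a \<Rightarrow> real"
  assumes "N > 0" and indep: "indep_vars (\<lambda>_. borel) X ({..<N} \<times> {..<N})"
    and D: "\<And>p. p \<in> {..<N} \<times> {..<N} \<Longrightarrow> distributed M lborel (X p) std_normal_density"
  shows "distr M (\<Pi>\<^sub>M p \<in> {..<N} \<times> {..<N}. borel) (\<lambda>\<omega>. \<lambda>p \<in> {..<N} \<times> {..<N}. X p \<omega>)
    = gaussian_entries N"
proof -
  have rv: "random_variable borel (X p)" if "p \<in> {..<N} \<times> {..<N}" for p
    using D[OF that] by (auto simp: distributed_def)
  have eq: "distr M borel (X p) = density lborel (\<lambda>x. ennreal (std_normal_density x))"
    if "p \<in> {..<N} \<times> {..<N}" for p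
  proof -
    have "distr M borel (X p) = distr M lborel (X p)" by (rule distr_cong) auto
    then show ?thesis using D[OF that] by (simp add: distributed_def)
  qed
  have "distr M (\<Pi>\<^sub>M p \<in> {..<N} \<times> {..<N}. borel) (\<lambda>\<omega>. \<lambda>p \<in> {..<N} \<times> {..<N}. X p \<omega>)
    = (\<Pi>\<^sub>M p \<in> {..<N} \<times> {..<N}. distr M borel (X p))"
    using \<open>N > 0\<close> indep rv by (subst indep_vars_iff_distr_eq_PiM'[symmetric]) auto
  also have "\<dots> = gaussian_entries N"
    unfolding gaussian_entries_def by (rule PiM_cong) (use eq in auto)
  finally show ?thesis .
qed

end

theory Submission
  imports Defs "HOL-Real_Asymp.Real_Asymp"
begin

text \<open>
  Two estimates are combined: the mean of the discrepancy is at least of order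
  \<open>N powr (1 / q + 1 / 2)\<close> (\<open>expectation_disc_ge\<close>), and its variance is at most of order
  \<open>N / (1 + (1 / 2 - 1 / q) * ln N)\<close> (\<open>variance_disc_le\<close>). The quotient \<open>x / 0\<close> is 0, so the
  variance must also be shown to be positive (\<open>variance_disc_pos\<close>).

  The lower bound on the mean is a union bound. For a fixed signing \<open>\<sigma>\<close> the coordinates of
  \<open>A \<sigma>\<close> are independent normals of variance \<open>N\<close>, and the probability that their Euclidean norm is
  below a small multiple of \<open>N\<close> decays faster than \<open>2 ^ - N\<close>. By the power mean inequality the
  \<open>\<ell>\<^sup>q\<close> norm is at least \<open>N powr (1 / q - 1 / 2)\<close> times the Euclidean one.

  A variance bound of order \<open>N\<close> would follow from Poincare's inequality. The logarithmic gain comes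
  from the fact that no entry has a large influence. Where the discrepancy is differentiable, its
  derivative in the entry \<open>(i, j)\<close> is \<open>w i * \<sigma> j\<close>, where \<open>\<sigma>\<close> is the optimal signing and \<open>w\<close> is
  the gradient of the \<open>\<ell>\<^sup>q\<close> norm at \<open>A \<sigma>\<close>. Since \<open>w\<close> has dual norm 1, its \<open>\<ell>\<^sup>2\<close> norm is at
  most 1 and its \<open>\<ell>\<^sup>1\<close> norm is at most \<open>N powr (1 / q)\<close>. So the energy (the mean squared length of
  the gradient) is at most \<open>N\<close>; and since the rows are exchangeable, each of the \<open>N\<^sup>2\<close> influences
  (the \<open>L\<^sup>1\<close> norms of the derivatives) is at most \<open>N powr (1 / q - 1)\<close>. An inequality of
  Talagrand's type, \<open>(1 + L) * variance \<le> energy + exp L * (sum of squared influences)\<close> for every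
  real \<open>L\<close>, turns this into the claim for \<open>L = (1 - 2 / q) * ln N\<close>.

  That inequality is proved on the discrete cube (\<open>cube_variance_L1_L2\<close>), where it follows by
  induction on the dimension from a two-point entropy inequality. It is transferred to Gaussian
  variables by writing every entry as the limit of normalised sums of signs
  (\<open>gaussian_variance_le_cube\<close>). On the cube the derivatives are differences along steps of
  positive length, which match the gradient only where the norm is smooth. The norm is therefore
  regularised by one additional coordinate equal to 1; this moves the discrepancy by at most 1 and,
  for \<open>q = \<infinity>\<close>, is combined with the replacement of \<open>q\<close> by a large finite exponent.
\<close>

section \<open>Variance, energy and influences on the discrete cube\<close>

text \<open>A point of the discrete cube \<open>{- 1, 1} ^ I\<close> is represented by the set \<open>S\<close> of its coordinates equal
  to 1, so that induction on the dimension is induction on the finite set \<open>I\<close>.\<close>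

definition cube_avg :: "'i set \<Rightarrow> ('i set \<Rightarrow> real) \<Rightarrow> real" where
  "cube_avg I f = (\<Sum>S\<in>Pow I. f S) / 2 ^ card I"

text \<open>The discrete derivative in direction \<open>e\<close>. It does not depend on whether \<open>e \<in> S\<close>.\<close>

definition flip_diff :: "'i \<Rightarrow> ('i set \<Rightarrow> real) \<Rightarrow> 'i set \<Rightarrow> real" where
  "flip_diff e f S = f (insert e S) - f (S - {e})"

lemma cube_avg_empty [simp]: "cube_avg {} f = f {}"
  by (simp add: cube_avg_def)

lemma cube_avg_insert:
  assumes "finite I" "a \<notin> I"
  shows "cube_avg (insert a I) f = (cube_avg I f + cube_avg I (\<lambda>S. f (insert a S))) / 2"
proof -
  have "(\<Sum>S\<in>Pow (insert a I). f S) = (\<Sum>S\<in>Pow I. f S) + (\<Sum>S\<in>insert a ` Pow I. f S)"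
    unfolding Pow_insert using assms by (intro sum.union_disjoint) auto
  also have "(\<Sum>S\<in>insert a ` Pow I. f S) = (\<Sum>S\<in>Pow I. f (insert a S))"
    using assms(2) by (subst sum.reindex) (auto simp: inj_on_def)
  finally show ?thesis using assms by (simp add: cube_avg_def field_simps)
qed

lemma cube_avg_cong: "(\<And>S. S \<subseteq> I \<Longrightarrow> f S = g S) \<Longrightarrow> cube_avg I f = cube_avg I g"
  unfolding cube_avg_def by (intro arg_cong2[where f="(/)"] sum.cong) auto

lemma cube_avg_mono: "(\<And>S. S \<subseteq> I \<Longrightarrow> f S \<le> g S) \<Longrightarrow> cube_avg I f \<le> cube_avg I g"
  unfolding cube_avg_def by (intro divide_right_mono sum_mono) auto

lemma cube_avg_nonneg: "(\<And>S. S \<subseteq> I \<Longrightarrow> 0 \<le> f S) \<Longrightarrow> 0 \<le> cube_avg I f"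
  unfolding cube_avg_def by (intro divide_nonneg_nonneg sum_nonneg) auto

lemma cube_avg_add: "cube_avg I (\<lambda>S. f S + g S) = cube_avg I f + cube_avg I g"
  by (simp add: cube_avg_def sum.distrib add_divide_distrib)

lemma cube_avg_diff: "cube_avg I (\<lambda>S. f S - g S) = cube_avg I f - cube_avg I g"
  by (simp add: cube_avg_def sum_subtractf diff_divide_distrib)

lemma cube_avg_cmult: "cube_avg I (\<lambda>S. c * f S) = c * cube_avg I f"
  by (simp add: cube_avg_def sum_distrib_left[symmetric])

lemma cube_avg_divide: "cube_avg I (\<lambda>S. f S / c) = cube_avg I f / c"
  using cube_avg_cmult[of I "1/c" f] by simp

lemma cube_avg_sum: "cube_avg I (\<lambda>S. \<Sum>x\<in>A. f x S) = (\<Sum>x\<in>A. cube_avg I (f x))"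
  unfolding cube_avg_def by (subst sum.swap) (simp add: sum_divide_distrib)

lemma cube_avg_const: "finite I \<Longrightarrow> cube_avg I (\<lambda>S. c) = c"
  by (simp add: cube_avg_def card_Pow)

lemma cube_avg_eq_0:
  assumes "finite I" "cube_avg I f = 0" "\<And>S. S \<subseteq> I \<Longrightarrow> 0 \<le> f S" "S \<subseteq> I"
  shows "f S = 0"
proof -
  have "(\<Sum>S\<in>Pow I. f S) = 0" using assms(2) by (simp add: cube_avg_def)
  then show ?thesis
    using assms by (subst (asm) sum_nonneg_eq_0_iff) auto
qed

lemma cube_avg_mult_le:
  "cube_avg I (\<lambda>S. f S * g S) \<le> sqrt (cube_avg I (\<lambda>S. (f S)\<^sup>2)) * sqrt (cube_avg I (\<lambda>S. (g S)\<^sup>2))"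
proof -
  let ?F = "\<Sum>S\<in>Pow I. (f S)\<^sup>2" and ?G = "\<Sum>S\<in>Pow I. (g S)\<^sup>2"
  have "(\<Sum>S\<in>Pow I. f S * g S) \<le> (\<Sum>S\<in>Pow I. \<bar>f S\<bar> * \<bar>g S\<bar>)"
    by (intro sum_mono) (simp add: abs_mult[symmetric])
  also have "\<dots> \<le> sqrt ?F * sqrt ?G"
    using L2_set_mult_ineq[of f g "Pow I"] by (simp add: L2_set_def)
  finally have "(\<Sum>S\<in>Pow I. f S * g S) / 2 ^ card I \<le> (sqrt ?F * sqrt ?G) / (sqrt (2 ^ card I) * sqrt (2 ^ card I))"
    by (simp add: divide_right_mono)
  then show ?thesis by (simp add: cube_avg_def real_sqrt_divide)
qed

lemma flip_diff_insert_left: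
  "e \<noteq> a \<Longrightarrow> flip_diff e f (insert a S) = flip_diff e (\<lambda>S. f (insert a S)) S"
  by (simp add: flip_diff_def insert_commute insert_Diff_if)

text \<open>Since \<open>ln x \<le> x - 1\<close>, the entropy of \<open>Z\<close> is at most \<open>Var Z / E Z\<close>; for
  \<open>Z = g\<^sup>2\<close> on two points this is already a logarithmic Sobolev inequality.\<close>

lemma two_point_log_sobolev:
  fixes a b :: real
  assumes "0 \<le> a" "0 \<le> b"
  defines "m \<equiv> (a\<^sup>2 + b\<^sup>2) / 2"
  shows "(a\<^sup>2 * ln (a\<^sup>2) + b\<^sup>2 * ln (b\<^sup>2)) / 2 - m * ln m \<le> (a - b)\<^sup>2"
proof (cases "m = 0")
  case True
  then have "a = 0" "b = 0" by (auto simp: m_def add_nonneg_eq_0_iff)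
  then show ?thesis by (simp add: m_def)
next
  case False
  then have m: "m > 0" by (simp add: m_def add_nonneg_nonneg less_le)
  have *: "x * ln x \<le> x * ln m + x * (x / m - 1)" if "0 \<le> x" for x
  proof (cases "x = 0")
    case False
    then have "x > 0" using that by simp
    then have "ln (x / m) \<le> x / m - 1" using m by (intro ln_le_minus_one) auto
    then have "ln x \<le> ln m + (x / m - 1)" using \<open>x > 0\<close> m by (simp add: ln_div)
    then show ?thesis using that mult_left_mono[of "ln x" "ln m + (x / m - 1)" x] by (simp add: algebra_simps)
  qed simp
  have "(a\<^sup>2 * ln (a\<^sup>2) + b\<^sup>2 * ln (b\<^sup>2)) / 2 - m * ln m
      \<le> ((a\<^sup>2 * ln m + a\<^sup>2 * (a\<^sup>2 / m - 1)) + (b\<^sup>2 * ln m + b\<^sup>2 * (b\<^sup>2 / m - 1))) / 2 - m * ln m"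
    by (intro diff_right_mono divide_right_mono add_mono *) auto
  also have "\<dots> = (a\<^sup>2 * (a\<^sup>2 / m - 1) + b\<^sup>2 * (b\<^sup>2 / m - 1)) / 2"
    by (simp add: m_def field_simps)
  also have "\<dots> = (a ^ 4 + b ^ 4) / (2 * m) - (a\<^sup>2 + b\<^sup>2) / 2"
    using m by (simp add: field_simps eval_nat_numeral)
  also have "\<dots> = (a ^ 4 + b ^ 4) / (2 * m) - m"
    by (simp add: m_def)
  also have "\<dots> \<le> (a - b)\<^sup>2"
  proof -
    have "(a - b)\<^sup>2 * ((a + b)\<^sup>2) \<le> (a - b)\<^sup>2 * (4 * m)"
      using sum_squares_bound[of a b]
      by (intro mult_left_mono) (auto simp: m_def power2_eq_square algebra_simps)
    moreover have "(a - b)\<^sup>2 * ((a + b)\<^sup>2) = 2 * (a ^ 4 + b ^ 4) - 4 * m * m"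
      by (simp add: m_def power2_eq_square power4_eq_xxxx field_simps)
    ultimately have "a ^ 4 + b ^ 4 \<le> ((a - b)\<^sup>2 + m) * (2 * m)"
      by (simp add: algebra_simps)
    then have "(a ^ 4 + b ^ 4) / (2 * m) \<le> (a - b)\<^sup>2 + m" using m by (simp add: pos_divide_le_eq)
    then show ?thesis by linarith
  qed
  finally show ?thesis .
qed

text \<open>Induction on the dimension. By the chain rule, the entropy of \<open>g\<^sup>2\<close> on \<open>insert a I\<close> is the mean
  of the entropies over the two faces plus the two-point entropy of the face averages \<open>A\<close> and \<open>B\<close>
  of \<open>g\<^sup>2\<close>. The latter is at most \<open>(sqrt A - sqrt B)\<^sup>2\<close>, a squared difference of \<open>L\<^sup>2\<close> norms, hence at
  most the energy in direction \<open>a\<close>.\<close>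

lemma cube_log_sobolev:
  assumes "finite I"
  shows "cube_avg I (\<lambda>S. (g S)\<^sup>2 * ln ((g S)\<^sup>2))
      - cube_avg I (\<lambda>S. (g S)\<^sup>2) * ln (cube_avg I (\<lambda>S. (g S)\<^sup>2))
    \<le> (\<Sum>e\<in>I. cube_avg I (\<lambda>S. (flip_diff e g S)\<^sup>2))"
  using assms
proof (induction I arbitrary: g rule: finite_induct)
  case (insert a I)
  define v where "v = (\<lambda>S. g (insert a S))"
  let ?Ent = "\<lambda>g. cube_avg I (\<lambda>S. (g S)\<^sup>2 * ln ((g S)\<^sup>2))
      - cube_avg I (\<lambda>S. (g S)\<^sup>2) * ln (cube_avg I (\<lambda>S. (g S)\<^sup>2))"
  define A where "A = cube_avg I (\<lambda>S. (g S)\<^sup>2)"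
  define B where "B = cube_avg I (\<lambda>S. (v S)\<^sup>2)"
  have AB: "A \<ge> 0" "B \<ge> 0" unfolding A_def B_def by (auto intro: cube_avg_nonneg)
  have tail: "(A * ln A + B * ln B) / 2 - (A + B) / 2 * ln ((A + B) / 2) \<le> (sqrt A - sqrt B)\<^sup>2"
    using two_point_log_sobolev[of "sqrt A" "sqrt B"] AB by simp
  have "cube_avg I (\<lambda>S. (v S - g S)\<^sup>2) = A + B - 2 * cube_avg I (\<lambda>S. g S * v S)"
    unfolding A_def B_def power2_diff
    by (simp add: cube_avg_add cube_avg_diff cube_avg_cmult mult.assoc mult.commute[of "v _"])
  moreover have "cube_avg I (\<lambda>S. g S * v S) \<le> sqrt A * sqrt B"
    unfolding A_def B_def by (rule cube_avg_mult_le)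
  moreover have "(sqrt A - sqrt B)\<^sup>2 = A + B - 2 * (sqrt A * sqrt B)"
    using AB by (simp add: power2_diff)
  ultimately have diff: "(sqrt A - sqrt B)\<^sup>2 \<le> cube_avg I (\<lambda>S. (v S - g S)\<^sup>2)"
    by linarith
  have a: "S - {a} = S" if "S \<subseteq> I" for S using that insert.hyps by auto
  have energy_a: "cube_avg (insert a I) (\<lambda>S. (flip_diff a g S)\<^sup>2) = cube_avg I (\<lambda>S. (v S - g S)\<^sup>2)"
  proof -
    have "cube_avg I (\<lambda>S. (flip_diff a g S)\<^sup>2) = cube_avg I (\<lambda>S. (v S - g S)\<^sup>2)"
      by (intro cube_avg_cong) (simp add: flip_diff_def v_def a)
    moreover have "cube_avg I (\<lambda>S. (flip_diff a g (insert a S))\<^sup>2) = cube_avg I (\<lambda>S. (v S - g S)\<^sup>2)"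
      by (intro cube_avg_cong) (simp add: flip_diff_def v_def a)
    ultimately show ?thesis using insert.hyps by (simp add: cube_avg_insert)
  qed
  have energy_e: "cube_avg (insert a I) (\<lambda>S. (flip_diff e g S)\<^sup>2)
      = (cube_avg I (\<lambda>S. (flip_diff e g S)\<^sup>2) + cube_avg I (\<lambda>S. (flip_diff e v S)\<^sup>2)) / 2"
    if "e \<in> I" for e
  proof -
    have "e \<noteq> a" using that insert.hyps by auto
    then show ?thesis using insert.hyps by (simp add: cube_avg_insert flip_diff_insert_left v_def)
  qed
  have "cube_avg (insert a I) (\<lambda>S. (g S)\<^sup>2 * ln ((g S)\<^sup>2))
      - cube_avg (insert a I) (\<lambda>S. (g S)\<^sup>2) * ln (cube_avg (insert a I) (\<lambda>S. (g S)\<^sup>2))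
    = (?Ent g + ?Ent v) / 2 + ((A * ln A + B * ln B) / 2 - (A + B) / 2 * ln ((A + B) / 2))"
    using insert.hyps by (simp add: cube_avg_insert A_def B_def v_def field_simps)
  also have "\<dots> \<le> ((\<Sum>e\<in>I. cube_avg I (\<lambda>S. (flip_diff e g S)\<^sup>2))
      + (\<Sum>e\<in>I. cube_avg I (\<lambda>S. (flip_diff e v S)\<^sup>2))) / 2 + cube_avg I (\<lambda>S. (v S - g S)\<^sup>2)"
    by (intro add_mono divide_right_mono order_trans[OF tail diff] insert.IH) auto
  also have "\<dots> = (\<Sum>e\<in>insert a I. cube_avg (insert a I) (\<lambda>S. (flip_diff e g S)\<^sup>2))"
    using insert.hyps
    by (simp add: energy_a energy_e sum.distrib sum_divide_distrib[symmetric])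
  finally show ?case .
qed simp

text \<open>A function whose \<open>L\<^sup>1\<close> norm is much smaller than its \<open>L\<^sup>2\<close> norm has large entropy: with
  \<open>V = E w\<^sup>2\<close> and \<open>T = E \<bar>w\<bar>\<close>, the entropy of \<open>w\<^sup>2\<close> is at least \<open>V * ln (V / T\<^sup>2)\<close>. This is stated in
  its family of tangent forms, indexed by \<open>L\<close>: unlike the logarithm, they can be added over the
  terms of a martingale decomposition.\<close>

lemma entropy_ge_L1_L2:
  fixes L :: real
  assumes "finite I"
  shows "(L + 1) * cube_avg I (\<lambda>S. (w S)\<^sup>2) - exp L * (cube_avg I (\<lambda>S. \<bar>w S\<bar>))\<^sup>2
    \<le> cube_avg I (\<lambda>S. (w S)\<^sup>2 * ln ((w S)\<^sup>2))
      - cube_avg I (\<lambda>S. (w S)\<^sup>2) * ln (cube_avg I (\<lambda>S. (w S)\<^sup>2))"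
proof -
  define V where "V = cube_avg I (\<lambda>S. (w S)\<^sup>2)"
  define T where "T = cube_avg I (\<lambda>S. \<bar>w S\<bar>)"
  have V0: "V \<ge> 0" and T0: "T \<ge> 0" unfolding V_def T_def by (auto intro: cube_avg_nonneg)
  show ?thesis
  proof (cases "V = 0 \<or> T = 0")
    case True
    then have "w S = 0" if "S \<subseteq> I" for S
      using cube_avg_eq_0[OF assms _ _ that, of "\<lambda>S. (w S)\<^sup>2"] cube_avg_eq_0[OF assms _ _ that, of "\<lambda>S. \<bar>w S\<bar>"]
      by (auto simp: V_def T_def)
    then have "cube_avg I (\<lambda>S. (w S)\<^sup>2 * ln ((w S)\<^sup>2)) = cube_avg I (\<lambda>S. 0)"
      "cube_avg I (\<lambda>S. (w S)\<^sup>2) = cube_avg I (\<lambda>S. 0)"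
      by (auto intro!: cube_avg_cong)
    then show ?thesis using assms by (simp add: cube_avg_const)
  next
    case False
    then have V: "V > 0" and T: "T > 0" using V0 T0 by auto
    (* The scale maximising 2 * ln s * V - 2 * s * T, to which \<open>\<bar>w S\<bar>\<close> is compared. *)
    define s where "s = V / T"
    have s: "s > 0" using V T by (simp add: s_def)
    have *: "2 * (ln s + 1) * (w S)\<^sup>2 - 2 * s * \<bar>w S\<bar> \<le> (w S)\<^sup>2 * ln ((w S)\<^sup>2)" for S
    proof (cases "w S = 0")
      case False
      then have "ln (s / \<bar>w S\<bar>) \<le> s / \<bar>w S\<bar> - 1" using s by (intro ln_le_minus_one) auto
      then have "ln s + 1 - s / \<bar>w S\<bar> \<le> ln \<bar>w S\<bar>" using s False by (simp add: ln_div)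
      then have "2 * (w S)\<^sup>2 * (ln s + 1 - s / \<bar>w S\<bar>) \<le> 2 * (w S)\<^sup>2 * ln \<bar>w S\<bar>"
        by (intro mult_left_mono) auto
      moreover have "ln ((w S)\<^sup>2) = 2 * ln \<bar>w S\<bar>"
        using False ln_realpow[of "\<bar>w S\<bar>" 2] by simp
      moreover have "(w S)\<^sup>2 * (s / \<bar>w S\<bar>) = s * \<bar>w S\<bar>"
        using False by (cases "w S > 0") (auto simp: power2_eq_square)
      moreover have "2 * (ln s + 1) * (w S)\<^sup>2 - 2 * (s * \<bar>w S\<bar>)
          = 2 * (w S)\<^sup>2 * (ln s + 1 - s / \<bar>w S\<bar>)"
        unfolding calculation(3)[symmetric] by (simp add: algebra_simps)
      ultimately show ?thesis by (simp add: mult_ac)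
    qed simp
    have "2 * (ln s + 1) * V - 2 * s * T \<le> cube_avg I (\<lambda>S. (w S)\<^sup>2 * ln ((w S)\<^sup>2))"
      unfolding V_def T_def cube_avg_cmult[symmetric] cube_avg_diff[symmetric]
      by (intro cube_avg_mono *)
    moreover have "2 * (ln s + 1) * V - 2 * s * T = 2 * V * ln s"
      using T by (simp add: s_def field_simps)
    moreover have "ln s = ln V - ln T" using V T by (simp add: s_def ln_div)
    moreover have "(L + 1) * V - exp L * T\<^sup>2 \<le> V * (ln V - 2 * ln T)"
    proof -
      have "ln (exp L * T\<^sup>2 / V) \<le> exp L * T\<^sup>2 / V - 1" using V T by (intro ln_le_minus_one) auto
      moreover have "ln (exp L * T\<^sup>2 / V) = L + 2 * ln T - ln V"
        using V T by (simp add: ln_div ln_mult ln_realpow)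
      ultimately have "V * (L + 1 - exp L * T\<^sup>2 / V) \<le> V * (ln V - 2 * ln T)"
        using V by (intro mult_left_mono) auto
      then show ?thesis using V by (simp add: algebra_simps)
    qed
    ultimately show ?thesis unfolding V_def[symmetric] T_def[symmetric]
      by (simp add: algebra_simps)
  qed
qed

text \<open>A linear form of Talagrand's \<open>L\<^sup>1\<close>-\<open>L\<^sup>2\<close> inequality, by the argument of Falik and
  Samorodnitsky. The variance is the sum of the squared \<open>L\<^sup>2\<close> norms of martingale differences, whose
  energies add up to at most the energy of \<open>f\<close>. The logarithmic Sobolev inequality bounds their
  entropies by these energies, and entropy dominates the \<open>L\<^sup>2\<close> norm unless the \<open>L\<^sup>1\<close> norm, which
  is controlled by an influence, is large. In the induction, averaging over the new coordinate
  splits \<open>f\<close> into its conditional mean \<open>g\<close> and a difference equal to \<open>w\<close> or \<open>- w\<close>.\<close>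

theorem cube_variance_L1_L2:
  fixes L :: real
  assumes "finite I"
  shows "(L + 1) * (cube_avg I (\<lambda>S. (f S)\<^sup>2) - (cube_avg I f)\<^sup>2)
    \<le> (\<Sum>e\<in>I. cube_avg I (\<lambda>S. (flip_diff e f S)\<^sup>2))
      + exp L * (\<Sum>e\<in>I. (cube_avg I (\<lambda>S. \<bar>flip_diff e f S\<bar>))\<^sup>2)"
  using assms
proof (induction I arbitrary: f rule: finite_induct)
  case (insert a I)
  define v where "v = (\<lambda>S. f (insert a S))"
  define g where "g = (\<lambda>S. (f S + v S) / 2)"
  define w where "w = (\<lambda>S. (v S - f S) / 2)"
  let ?I = "insert a I"
  let ?var = "\<lambda>f. cube_avg I (\<lambda>S. (f S)\<^sup>2) - (cube_avg I f)\<^sup>2"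
  have split2: "((x + y) / 2)\<^sup>2 + ((y - x) / 2)\<^sup>2 = (x\<^sup>2 + y\<^sup>2) / 2" for x y :: real
    by (simp add: power2_eq_square field_simps)
  have avg2: "cube_avg ?I (\<lambda>S. (f S)\<^sup>2) = cube_avg I (\<lambda>S. (g S)\<^sup>2) + cube_avg I (\<lambda>S. (w S)\<^sup>2)"
    unfolding cube_avg_add[symmetric] using insert.hyps
    by (simp add: cube_avg_insert g_def w_def split2 cube_avg_divide cube_avg_add v_def)
  have avg1: "cube_avg ?I f = cube_avg I g"
    using insert.hyps by (simp add: cube_avg_insert g_def cube_avg_divide cube_avg_add v_def)
  have diff_e: "cube_avg ?I (\<lambda>S. h (flip_diff e f S))
      = cube_avg I (\<lambda>S. (h (flip_diff e f S) + h (flip_diff e v S)) / 2)" if "e \<in> I" for e h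
  proof -
    have "e \<noteq> a" using that insert.hyps by auto
    then show ?thesis
      using insert.hyps by (simp add: cube_avg_insert flip_diff_insert_left v_def cube_avg_divide cube_avg_add)
  qed
  have lin: "flip_diff e g S = (flip_diff e f S + flip_diff e v S) / 2"
    "flip_diff e w S = (flip_diff e v S - flip_diff e f S) / 2" for e S
    by (auto simp: flip_diff_def g_def w_def field_simps)
  have energy: "cube_avg I (\<lambda>S. (flip_diff e g S)\<^sup>2) + cube_avg I (\<lambda>S. (flip_diff e w S)\<^sup>2)
      = cube_avg ?I (\<lambda>S. (flip_diff e f S)\<^sup>2)" if "e \<in> I" for e
    unfolding diff_e[OF that, where h="\<lambda>x. x\<^sup>2"] cube_avg_add[symmetric] lin split2 ..
  have infl: "cube_avg I (\<lambda>S. \<bar>flip_diff e g S\<bar>) \<le> cube_avg ?I (\<lambda>S. \<bar>flip_diff e f S\<bar>)"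
    if "e \<in> I" for e
    unfolding diff_e[OF that, where h=abs] lin by (intro cube_avg_mono) auto
  have infl_a: "cube_avg I (\<lambda>S. \<bar>w S\<bar>) \<le> cube_avg ?I (\<lambda>S. \<bar>flip_diff a f S\<bar>)"
  proof -
    have "cube_avg I (\<lambda>S. \<bar>flip_diff a f S\<bar>) = cube_avg I (\<lambda>S. 2 * \<bar>w S\<bar>)"
      "cube_avg I (\<lambda>S. \<bar>flip_diff a f (insert a S)\<bar>) = cube_avg I (\<lambda>S. 2 * \<bar>w S\<bar>)"
      using insert.hyps by (intro cube_avg_cong, force simp: flip_diff_def v_def w_def)+
    then have "cube_avg ?I (\<lambda>S. \<bar>flip_diff a f S\<bar>) = 2 * cube_avg I (\<lambda>S. \<bar>w S\<bar>)"
      using insert.hyps by (simp add: cube_avg_insert cube_avg_cmult)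
    then show ?thesis using cube_avg_nonneg[of I "\<lambda>S. \<bar>w S\<bar>"] by simp
  qed
  have "(L + 1) * cube_avg I (\<lambda>S. (w S)\<^sup>2) - exp L * (cube_avg I (\<lambda>S. \<bar>w S\<bar>))\<^sup>2
      \<le> (\<Sum>e\<in>I. cube_avg I (\<lambda>S. (flip_diff e w S)\<^sup>2))"
    using entropy_ge_L1_L2[OF insert.hyps(1), of L w] cube_log_sobolev[OF insert.hyps(1), of w]
    by linarith
  then have "(L + 1) * (cube_avg ?I (\<lambda>S. (f S)\<^sup>2) - (cube_avg ?I f)\<^sup>2)
      \<le> (\<Sum>e\<in>I. cube_avg I (\<lambda>S. (flip_diff e g S)\<^sup>2))
        + exp L * (\<Sum>e\<in>I. (cube_avg I (\<lambda>S. \<bar>flip_diff e g S\<bar>))\<^sup>2)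
        + (\<Sum>e\<in>I. cube_avg I (\<lambda>S. (flip_diff e w S)\<^sup>2))
        + exp L * (cube_avg I (\<lambda>S. \<bar>w S\<bar>))\<^sup>2"
    unfolding avg1 avg2 using insert.IH[of g] by (simp add: algebra_simps)
  also have "\<dots> = (\<Sum>e\<in>I. cube_avg ?I (\<lambda>S. (flip_diff e f S)\<^sup>2))
      + exp L * ((cube_avg I (\<lambda>S. \<bar>w S\<bar>))\<^sup>2 + (\<Sum>e\<in>I. (cube_avg I (\<lambda>S. \<bar>flip_diff e g S\<bar>))\<^sup>2))"
    using energy by (simp add: sum.distrib[symmetric] algebra_simps)
  also have "\<dots> \<le> (\<Sum>e\<in>?I. cube_avg ?I (\<lambda>S. (flip_diff e f S)\<^sup>2))
      + exp L * (\<Sum>e\<in>?I. (cube_avg ?I (\<lambda>S. \<bar>flip_diff e f S\<bar>))\<^sup>2)"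
    unfolding sum.insert[OF insert.hyps]
    using infl infl_a
    by (intro add_mono mult_left_mono sum_mono power_mono)
      (auto intro!: cube_avg_nonneg simp: add_increasing)
  finally show ?case .
qed simp

text \<open>Flipping a coordinate preserves the uniform distribution, so the two-sided differences may be
  replaced by one-sided ones: only increases of \<open>f\<close> under a flip have to be controlled.\<close>

lemma flip_diff_one_sided:
  fixes f u :: "'i set \<Rightarrow> real"
  assumes "finite I" "e \<in> I" "p > 0"
    and up: "\<And>S. S \<subseteq> I \<Longrightarrow> f (insert e S) - f S \<le> u S" "\<And>S. S \<subseteq> I \<Longrightarrow> f (S - {e}) - f S \<le> u S"
    and u0: "\<And>S. S \<subseteq> I \<Longrightarrow> 0 \<le> u S"
  shows "cube_avg I (\<lambda>S. \<bar>flip_diff e f S\<bar> ^ p) \<le> 2 * cube_avg I (\<lambda>S. u S ^ p)"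
proof -
  define I' where "I' = I - {e}"
  have I: "I = insert e I'" "finite I'" "e \<notin> I'" using assms(1,2) by (auto simp: I'_def)
  have b: "\<bar>flip_diff e f S\<bar> ^ p \<le> u S ^ p + u (insert e S) ^ p"
    "\<bar>flip_diff e f (insert e S)\<bar> ^ p \<le> u S ^ p + u (insert e S) ^ p" if "S \<subseteq> I'" for S
  proof -
    have S: "S \<subseteq> I" "insert e S \<subseteq> I" "e \<notin> S" using that I by auto
    have "f (insert e S) - f S \<le> u S" "f S - f (insert e S) \<le> u (insert e S)"
      using up(1)[OF S(1)] up(2)[OF S(2)] S(3) by auto
    then have "\<bar>f (insert e S) - f S\<bar> \<le> u S \<or> \<bar>f (insert e S) - f S\<bar> \<le> u (insert e S)"
      by linarith
    then have "\<bar>f (insert e S) - f S\<bar> ^ p \<le> u S ^ p \<or> \<bar>f (insert e S) - f S\<bar> ^ p \<le> u (insert e S) ^ p"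
      by (auto intro: power_mono)
    moreover have "0 \<le> u S ^ p" "0 \<le> u (insert e S) ^ p" using u0 S by auto
    ultimately have "\<bar>f (insert e S) - f S\<bar> ^ p \<le> u S ^ p + u (insert e S) ^ p" by linarith
    then show "\<bar>flip_diff e f S\<bar> ^ p \<le> u S ^ p + u (insert e S) ^ p"
      "\<bar>flip_diff e f (insert e S)\<bar> ^ p \<le> u S ^ p + u (insert e S) ^ p"
      using S(3) by (simp_all add: flip_diff_def)
  qed
  have "cube_avg I' (\<lambda>S. \<bar>flip_diff e f S\<bar> ^ p) \<le> cube_avg I' (\<lambda>S. u S ^ p + u (insert e S) ^ p)"
    "cube_avg I' (\<lambda>S. \<bar>flip_diff e f (insert e S)\<bar> ^ p) \<le> cube_avg I' (\<lambda>S. u S ^ p + u (insert e S) ^ p)"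
    using b by (auto intro: cube_avg_mono)
  then show ?thesis unfolding I(1) using I by (simp add: cube_avg_insert cube_avg_add)
qed

text \<open>Used with a permutation of the rows of a matrix.\<close>

lemma cube_avg_permute:
  assumes "bij_betw \<pi> I I"
  shows "cube_avg I (\<lambda>S. f (\<pi> ` S)) = cube_avg I f"
  unfolding cube_avg_def using bij_betw_Pow[OF assms] by (subst sum.reindex_bij_betw) auto

section \<open>A regularised discrepancy\<close>

lemma powr_above_tangent:
  fixes x y r :: real
  assumes "1 \<le> r" "0 \<le> x" "0 \<le> y"
  shows "r * y powr (r - 1) * (x - y) \<le> x powr r - y powr r"
proof (cases "y = 0")
  case False
  then have y: "y > 0" using assms by simp
  have yr: "y powr r = y * y powr (r - 1)" using y by (simp add: powr_mult_base)
  show ?thesis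
  proof (cases "x = 0")
    case True
    have "1 * y powr r \<le> r * y powr r" using assms by (intro mult_right_mono) auto
    then show ?thesis using True yr by (simp add: mult.assoc mult.commute[of "y powr (r - 1)"])
  next
    case False
    then have x: "x > 0" using assms by simp
    have "(r * y powr (r - 1)) * (x - y) \<le> x powr r - y powr r"
    proof (rule convex_on_imp_above_tangent)
      show "convex_on {0<..} (\<lambda>x. x powr r)" using assms by (intro powr_convex)
      show "connected {0::real<..}" by simp
      show "y \<in> interior {0<..}" "x \<in> {0<..}" using x y by (auto simp: interior_open)
      show "((\<lambda>x. x powr r) has_real_derivative r * y powr (r - 1)) (at y within {0<..})"
        using y by (auto intro!: derivative_eq_intros DERIV_subset[OF has_real_derivative_powr])
    qed
    then show ?thesis .
  qed
qed (use assms in auto)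

text \<open>Both \<open>x + h\<close> and \<open>y\<close> are convex combinations of \<open>x\<close> and \<open>y + h\<close>, with complementary weights.
  The convexity on the closed half line is read off the tangent inequality.\<close>

lemma powr_increment_mono:
  fixes x y h r :: real
  assumes "1 \<le> r" "0 \<le> x" "x \<le> y" "0 \<le> h"
  shows "(x + h) powr r - x powr r \<le> (y + h) powr r - y powr r"
proof (cases "h = 0 \<or> x = y")
  case False
  then have h: "h > 0" and xy: "x < y" using assms by auto
  define d where "d = y + h - x"
  have d: "d > 0" using h xy by (simp add: d_def)
  have conv: "d * z powr r \<le> (y + h - z) * x powr r + (z - x) * (y + h) powr r"
    if z: "x \<le> z" "z \<le> y + h" for z
  proof -
    let ?s = "r * z powr (r - 1)"
    have "(y + h - z) * (?s * (x - z)) \<le> (y + h - z) * (x powr r - z powr r)"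
      using z assms powr_above_tangent[of r x z] by (intro mult_left_mono) auto
    moreover have "(z - x) * (?s * (y + h - z)) \<le> (z - x) * ((y + h) powr r - z powr r)"
      using z assms powr_above_tangent[of r "y + h" z] by (intro mult_left_mono) auto
    ultimately show ?thesis by (simp add: d_def algebra_simps)
  qed
  have "d * ((x + h) powr r + y powr r) \<le> d * (x powr r + (y + h) powr r)"
    using conv[of "x + h"] conv[of y] h xy by (simp add: d_def algebra_simps)
  then have "(x + h) powr r + y powr r \<le> x powr r + (y + h) powr r"
    using d by (simp only: mult_le_cancel_left_pos)
  then show ?thesis by linarith
qed auto

lemma powr_le_cancel_exponent:
  fixes x y r :: real
  assumes "0 < r" "0 \<le> y" "x powr r \<le> y powr r"
  shows "x \<le> y"
  using assms powr_less_mono2[of r y x] by linarith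

text \<open>This is the \<open>\<ell>\<^sup>r\<close> norm of \<open>v\<close> extended by one coordinate equal to 1. The extra coordinate changes
  the norm by at most 1 but keeps it away from 0, where the norm is not differentiable.\<close>

definition reg_norm :: "real \<Rightarrow> nat \<Rightarrow> (nat \<Rightarrow> real) \<Rightarrow> real" where
  "reg_norm r N v = ((\<Sum>i<N. \<bar>v i\<bar> powr r) + 1) powr (1 / r)"

lemma reg_norm_powr:
  assumes "0 < r"
  shows "reg_norm r N v powr r = (\<Sum>i<N. \<bar>v i\<bar> powr r) + 1"
proof -
  have "0 \<le> (\<Sum>i<N. \<bar>v i\<bar> powr r)" by (intro sum_nonneg) auto
  then show ?thesis using assms by (simp add: reg_norm_def powr_powr)
qed

lemma reg_norm_ge_1:
  assumes "0 < r"
  shows "1 \<le> reg_norm r N v"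
proof -
  have "0 \<le> (\<Sum>i<N. \<bar>v i\<bar> powr r)" by (intro sum_nonneg) auto
  then show ?thesis using assms unfolding reg_norm_def by (intro ge_one_powr_ge_zero) auto
qed

lemma abs_le_reg_norm:
  assumes "0 < r" "i < N"
  shows "\<bar>v i\<bar> \<le> reg_norm r N v"
proof -
  have "\<bar>v i\<bar> powr r \<le> (\<Sum>i<N. \<bar>v i\<bar> powr r)"
    using assms by (intro member_le_sum) auto
  then have "\<bar>v i\<bar> powr r \<le> reg_norm r N v powr r"
    using reg_norm_powr[OF assms(1), of N v] by simp
  then show ?thesis
    using assms reg_norm_ge_1[OF assms(1), of N v]
    by - (rule powr_le_cancel_exponent[of r], auto)
qed

lemma reg_norm_upd_powr:
  assumes "0 < r" "i < N"
  shows "reg_norm r N (v(i := y)) powr r = reg_norm r N v powr r + (\<bar>y\<bar> powr r - \<bar>v i\<bar> powr r)"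
proof -
  have "(\<Sum>k<N. \<bar>w k\<bar> powr r) = \<bar>w i\<bar> powr r + (\<Sum>k\<in>{..<N} - {i}. \<bar>w k\<bar> powr r)" for w :: "nat \<Rightarrow> real"
    using assms by (intro sum.remove) auto
  from this[of v] this[of "v(i := y)"] show ?thesis
    unfolding reg_norm_powr[OF assms(1)] by simp
qed

text \<open>The weight is the \<open>i\<close>-th partial derivative of the norm, evaluated with \<open>\<bar>v i\<bar>\<close> enlarged by \<open>h\<close>
  to account for a step of positive length. The tangent inequality is applied twice: to the norm
  at the old value and to the power of the coordinate at the new one.\<close>

lemma reg_norm_upd_le_weight:
  assumes r: "1 \<le> r" and i: "i < N" and y: "\<bar>y - v i\<bar> \<le> h"
  shows "reg_norm r N (v(i := y)) - reg_norm r N v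
    \<le> h * ((\<bar>v i\<bar> + h) / reg_norm r N v) powr (r - 1)"
proof -
  define g where "g = reg_norm r N v"
  define B where "B = reg_norm r N (v(i := y))"
  define z where "z = \<bar>v i\<bar> + h"
  have g: "g \<ge> 1" and B: "B \<ge> 1" unfolding g_def B_def using r by (auto intro: reg_norm_ge_1)
  have h: "h \<ge> 0" using y by linarith
  have z: "z \<ge> 0" "\<bar>y\<bar> \<le> z" using h y by (auto simp: z_def)
  have "r * g powr (r - 1) * (B - g) \<le> B powr r - g powr r"
    using powr_above_tangent[of r B g] r g B by simp
  also have "\<dots> = \<bar>y\<bar> powr r - \<bar>v i\<bar> powr r"
    using reg_norm_upd_powr[of r i N v y] r i by (simp add: B_def g_def)
  also have "\<dots> \<le> z powr r - \<bar>v i\<bar> powr r"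
    using z r by (simp add: powr_mono2)
  also have "\<dots> \<le> r * z powr (r - 1) * h"
    using powr_above_tangent[of r "\<bar>v i\<bar>" z] r z by (simp add: z_def)
  finally have "r * (g powr (r - 1) * (B - g)) \<le> r * (z powr (r - 1) * h)" by (simp add: mult.assoc)
  then have "g powr (r - 1) * (B - g) \<le> z powr (r - 1) * h" using r by simp
  then have "B - g \<le> (z powr (r - 1) * h) / g powr (r - 1)"
    using g by (simp add: pos_le_divide_eq mult.commute)
  also have "\<dots> = h * (z / g) powr (r - 1)"
    using z g by (simp add: powr_divide)
  finally show ?thesis by (simp add: B_def g_def z_def)
qed

lemma reg_norm_upd_le:
  assumes r: "1 \<le> r" and i: "i < N"
  shows "reg_norm r N (v(i := y)) \<le> reg_norm r N v + \<bar>y - v i\<bar>"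
proof -
  define h where "h = \<bar>y - v i\<bar>"
  define g where "g = reg_norm r N v"
  have g: "g \<ge> 1" "\<bar>v i\<bar> \<le> g" unfolding g_def using r i by (auto intro: reg_norm_ge_1 abs_le_reg_norm)
  have "reg_norm r N (v(i := y)) powr r = g powr r + (\<bar>y\<bar> powr r - \<bar>v i\<bar> powr r)"
    using reg_norm_upd_powr[of r i N v y] r i by (simp add: g_def)
  also have "\<bar>y\<bar> powr r \<le> (\<bar>v i\<bar> + h) powr r"
    using r by (intro powr_mono2) (auto simp: h_def)
  also have "(\<bar>v i\<bar> + h) powr r - \<bar>v i\<bar> powr r \<le> (g + h) powr r - g powr r"
    using r g by (intro powr_increment_mono) (auto simp: h_def)
  finally have "reg_norm r N (v(i := y)) powr r \<le> (g + h) powr r" by simp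
  then have "reg_norm r N (v(i := y)) \<le> g + h"
    using r g by - (rule powr_le_cancel_exponent[of r], auto simp: h_def)
  then show ?thesis by (simp add: g_def h_def)
qed

lemma reg_norm_le_add:
  assumes r: "1 \<le> r"
  shows "reg_norm r N w \<le> reg_norm r N v + (\<Sum>i<N. \<bar>w i - v i\<bar>)"
proof -
  define u where "u = (\<lambda>n i. if i < n then w i else v i)"
  have "reg_norm r N (u n) \<le> reg_norm r N v + (\<Sum>i<n. \<bar>w i - v i\<bar>)" if "n \<le> N" for n
    using that
  proof (induction n)
    case (Suc n)
    have "u (Suc n) = (u n)(n := w n)" by (auto simp: u_def fun_eq_iff less_Suc_eq)
    then have "reg_norm r N (u (Suc n)) \<le> reg_norm r N (u n) + \<bar>w n - v n\<bar>"
      using reg_norm_upd_le[OF r, of n N "u n" "w n"] Suc.prems by (simp add: u_def)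
    then show ?case using Suc by simp
  qed (simp add: u_def)
  from this[of N] have "reg_norm r N (u N) \<le> reg_norm r N v + (\<Sum>i<N. \<bar>w i - v i\<bar>)" by simp
  moreover have "reg_norm r N (u N) = reg_norm r N w" by (simp add: reg_norm_def u_def)
  ultimately show ?thesis by simp
qed

text \<open>For short steps \<open>h\<close>, uniformly in \<open>v\<close>, enlarging the coordinates by \<open>h\<close> at most doubles the sum
  of the powers: coordinates that are large compared with \<open>h\<close> grow by a factor close to 1, and the
  small ones contribute less than the regularising coordinate.\<close>

lemma reg_norm_weights_sum:
  assumes r: "1 \<le> r"
  obtains h\<^sub>0 where "h\<^sub>0 > 0"
    "\<And>h v. 0 < h \<Longrightarrow> h \<le> h\<^sub>0 \<Longrightarrow> (\<Sum>i<N. ((\<bar>v i\<bar> + h) / reg_norm r N v) powr r) \<le> 2"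
proof -
  define \<eta> where "\<eta> = 2 powr (1 / r) - (1::real)"
  have \<eta>: "\<eta> > 0" using r by (simp add: \<eta>_def gr_one_powr)
  have \<eta>r: "(1 + \<eta>) powr r = 2" using r by (simp add: \<eta>_def powr_powr)
  define K where "K = (1 / \<eta> + 1) powr r"
  define h\<^sub>0 where "h\<^sub>0 = (2 / (real N * K + 1)) powr (1 / r)"
  have "1 / \<eta> + 1 > 0" using \<eta> by (simp add: add_pos_pos)
  then have K: "K > 0" by (simp add: K_def)
  have NK0: "real N * K + 1 > 0" using K by (simp add: add_nonneg_pos)
  then have h0: "h\<^sub>0 > 0" by (simp add: h\<^sub>0_def)
  have "(\<Sum>i<N. ((\<bar>v i\<bar> + h) / reg_norm r N v) powr r) \<le> 2" if h: "0 < h" "h \<le> h\<^sub>0" for h v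
  proof -
    define g where "g = reg_norm r N v"
    have g: "g \<ge> 1" using r by (simp add: g_def reg_norm_ge_1)
    have *: "(x + h) powr r \<le> 2 * x powr r + K * h powr r" if x: "x \<ge> 0" for x
    proof (cases "h \<le> \<eta> * x")
      case True
      then have "(x + h) powr r \<le> ((1 + \<eta>) * x) powr r"
        using r x h by (intro powr_mono2) (auto simp: algebra_simps)
      also have "\<dots> = 2 * x powr r" using x \<eta> \<eta>r by (simp add: powr_mult)
      finally show ?thesis using K by (simp add: add_increasing2)
    next
      case False
      then have "x \<le> h / \<eta>" using \<eta> by (simp add: pos_le_divide_eq mult.commute)
      then have "(x + h) powr r \<le> ((1 / \<eta> + 1) * h) powr r"
        using r x h by (intro powr_mono2) (auto simp: algebra_simps)
      also have "\<dots> = K * h powr r" using h \<eta> by (simp add: powr_mult K_def)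
      finally show ?thesis using K by (simp add: add_increasing)
    qed
    have "h powr r \<le> h\<^sub>0 powr r" using h r by (intro powr_mono2) auto
    also have "\<dots> = 2 / (real N * K + 1)" using r NK0 by (simp add: h\<^sub>0_def powr_powr)
    finally have "(real N * K + 1) * h powr r \<le> 2" using NK0 by (simp add: pos_le_divide_eq mult.commute)
    then have NK: "real N * K * h powr r \<le> 2" using powr_ge_zero[of h r] unfolding distrib_right by linarith
    have "(\<Sum>i<N. (\<bar>v i\<bar> + h) powr r) \<le> (\<Sum>i<N. 2 * \<bar>v i\<bar> powr r + K * h powr r)"
      by (intro sum_mono *) auto
    also have "\<dots> = 2 * (\<Sum>i<N. \<bar>v i\<bar> powr r) + real N * K * h powr r"
      by (simp add: sum.distrib sum_distrib_left)
    also have "\<dots> \<le> 2 * g powr r"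
      using NK reg_norm_powr[of r N v] r by (simp add: g_def)
    finally have "(\<Sum>i<N. (\<bar>v i\<bar> + h) powr r) / g powr r \<le> 2"
      using g by (simp add: pos_divide_le_eq)
    then show ?thesis
      using g h by (simp add: g_def[symmetric] powr_divide sum_divide_distrib)
  qed
  with h0 show thesis by (rule that)
qed

text \<open>The gradient of the \<open>\<ell>\<^sup>r\<close> norm has dual norm at most 1, and the dual exponent lies between 1 and 2;
  hence its \<open>\<ell>\<^sup>2\<close> norm is bounded and its \<open>\<ell>\<^sup>1\<close> norm is at most of order \<open>N powr (1 / r)\<close>.\<close>

lemma weights_L1_L2:
  assumes r: "2 \<le> r" and a: "\<And>i. i < N \<Longrightarrow> 0 \<le> a i" and s: "(\<Sum>i<N. a i powr r) \<le> 2"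
  shows "(\<Sum>i<N. a i powr (r - 1)) \<le> 3 * real N powr (1 / r)"
    and "(\<Sum>i<N. (a i powr (r - 1))\<^sup>2) \<le> 4"
proof -
  show "(\<Sum>i<N. a i powr (r - 1)) \<le> 3 * real N powr (1 / r)"
  proof (cases "N = 0")
    case False
    then have N: "real N > 0" by simp
    (* The common value of the coordinates of a flat vector of norm 1; comparing each \<open>a i\<close>
       with it replaces Hoelder's inequality. *)
    define b where "b = real N powr (- 1 / r)"
    have b: "b > 0" using N by (simp add: b_def)
    have "b powr r = real N powr (- 1 / r * r)" by (simp only: b_def powr_powr)
    then have br: "b powr r = 1 / N" using N r by (simp add: powr_minus_divide)
    have pm: "x powr (r - 1) * x = x powr r" if "x \<ge> 0" for x :: real
      using that r by (cases "x = 0") (auto simp: powr_mult_base mult.commute)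
    have *: "a i powr (r - 1) * b \<le> a i powr r + b powr r" if "i < N" for i
    proof (cases "a i \<le> b")
      case True
      then have "a i powr (r - 1) * b \<le> b powr (r - 1) * b"
        using a[OF that] r b by (intro mult_right_mono powr_mono2) auto
      then show ?thesis using b pm[of b] by (simp add: add_increasing)
    next
      case False
      then have "a i powr (r - 1) * b \<le> a i powr (r - 1) * a i"
        using a[OF that] r b by (intro mult_left_mono) auto
      then show ?thesis using pm[of "a i"] a[OF that] by (simp add: add_increasing2)
    qed
    have "(\<Sum>i<N. a i powr (r - 1)) * b \<le> (\<Sum>i<N. a i powr r + b powr r)"
      unfolding sum_distrib_right by (intro sum_mono *) auto
    also have "\<dots> \<le> 3" using s N by (simp add: sum.distrib br)
    finally have "(\<Sum>i<N. a i powr (r - 1)) \<le> 3 / b" using b by (simp add: pos_le_divide_eq)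
    also have "3 / b = 3 * real N powr (1 / r)" using N by (simp add: b_def powr_minus_divide)
    finally show ?thesis .
  qed simp
  have "(a i powr (r - 1))\<^sup>2 \<le> 2 * a i powr r" if "i < N" for i
  proof -
    have "a i powr r \<le> (\<Sum>i<N. a i powr r)" using that by (intro member_le_sum) auto
    then have "a i powr r \<le> 2" using s by linarith
    then have "(a i powr r) powr ((r - 2) / r) \<le> 2 powr ((r - 2) / r)"
      using r by (intro powr_mono2) auto
    also have "\<dots> \<le> 2 powr 1" using r by (intro powr_mono) (auto simp: field_simps)
    finally have "a i powr (r - 2) \<le> 2" using r by (simp add: powr_powr)
    then have "a i powr r * a i powr (r - 2) \<le> a i powr r * 2" by (intro mult_left_mono) auto
    moreover have "(a i powr (r - 1))\<^sup>2 = a i powr r * a i powr (r - 2)"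
      by (simp add: power2_eq_square powr_add[symmetric])
    ultimately show ?thesis by simp
  qed
  then have "(\<Sum>i<N. (a i powr (r - 1))\<^sup>2) \<le> (\<Sum>i<N. 2 * a i powr r)" by (intro sum_mono) auto
  then show "(\<Sum>i<N. (a i powr (r - 1))\<^sup>2) \<le> 4" using s by (simp add: sum_distrib_left[symmetric])
qed

definition mat_act :: "nat \<Rightarrow> (nat \<times> nat \<Rightarrow> real) \<Rightarrow> real vec \<Rightarrow> nat \<Rightarrow> real" where
  "mat_act N A \<sigma> i = (\<Sum>j<N. A (i, j) * \<sigma> $ j)"

definition reg_disc :: "real \<Rightarrow> nat \<Rightarrow> (nat \<times> nat \<Rightarrow> real) \<Rightarrow> real" where
  "reg_disc r N A = Min ((\<lambda>\<sigma>. reg_norm r N (mat_act N A \<sigma>)) ` sign_vecs N)"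

lemma Min_image_le_affine:
  fixes f g :: "'a \<Rightarrow> real"
  assumes "finite S" "S \<noteq> {}" "\<And>x. x \<in> S \<Longrightarrow> f x \<le> a * g x + b"
  shows "Min (f ` S) \<le> a * Min (g ` S) + b"
proof -
  have "Min (g ` S) \<in> g ` S" using assms by (intro Min_in) auto
  then obtain x where x: "x \<in> S" "Min (g ` S) = g x" by auto
  have "Min (f ` S) \<le> f x" using assms x by (intro Min_le) auto
  then show ?thesis using assms(3)[OF x(1)] x(2) by simp
qed

lemmas Min_sign_vecs_le = Min_image_le_affine[OF finite_sign_vecs sign_vecs_nonempty]

lemma sign_vecs_abs: "\<sigma> \<in> sign_vecs N \<Longrightarrow> j < N \<Longrightarrow> \<bar>\<sigma> $ j\<bar> = 1"
  by (auto simp: sign_vecs_def)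

lemma reg_disc_le_add:
  assumes r: "1 \<le> r"
  shows "reg_disc r N A \<le> reg_disc r N B + (\<Sum>p\<in>{..<N}\<times>{..<N}. \<bar>A p - B p\<bar>)"
proof -
  have "reg_norm r N (mat_act N A \<sigma>) \<le> 1 * reg_norm r N (mat_act N B \<sigma>) + (\<Sum>p\<in>{..<N}\<times>{..<N}. \<bar>A p - B p\<bar>)"
    if s: "\<sigma> \<in> sign_vecs N" for \<sigma>
  proof -
  have "\<bar>mat_act N A \<sigma> i - mat_act N B \<sigma> i\<bar> \<le> (\<Sum>j<N. \<bar>A (i, j) - B (i, j)\<bar>)" for i
  proof -
    have "mat_act N A \<sigma> i - mat_act N B \<sigma> i = (\<Sum>j<N. (A (i, j) - B (i, j)) * \<sigma> $ j)"
      by (simp add: mat_act_def sum_subtractf left_diff_distrib)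
    also have "\<bar>\<dots>\<bar> \<le> (\<Sum>j<N. \<bar>(A (i, j) - B (i, j)) * \<sigma> $ j\<bar>)" by (rule sum_abs)
    also have "\<dots> = (\<Sum>j<N. \<bar>A (i, j) - B (i, j)\<bar>)"
      using sign_vecs_abs[OF s] by (intro sum.cong) (auto simp: abs_mult)
    finally show ?thesis .
  qed
  then have "(\<Sum>i<N. \<bar>mat_act N A \<sigma> i - mat_act N B \<sigma> i\<bar>) \<le> (\<Sum>i<N. \<Sum>j<N. \<bar>A (i, j) - B (i, j)\<bar>)"
    by (intro sum_mono) auto
  also have "\<dots> = (\<Sum>p\<in>{..<N}\<times>{..<N}. \<bar>A p - B p\<bar>)"
    by (simp add: sum.cartesian_product)
  finally show ?thesis
    using reg_norm_le_add[OF r, of N "mat_act N A \<sigma>" "mat_act N B \<sigma>"] by linarith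
  qed
  from Min_sign_vecs_le[OF this] show ?thesis by (simp add: reg_disc_def)
qed

text \<open>A signing that is optimal for \<open>A\<close> is still available after an entry has changed. So increases of
  the discrepancy are bounded by the increments of a single norm, although the minimum over signings
  is not differentiable. The weights depend on \<open>A\<close> but not on the entry's column.\<close>

lemma reg_disc_one_sided:
  assumes r: "2 \<le> r"
  obtains h\<^sub>0 where "h\<^sub>0 > 0"
    "\<And>h A. 0 < h \<Longrightarrow> h \<le> h\<^sub>0 \<Longrightarrow> \<exists>w. (\<forall>i. 0 \<le> w i) \<and> (\<Sum>i<N. w i) \<le> 3 * real N powr (1 / r)
      \<and> (\<Sum>i<N. (w i)\<^sup>2) \<le> 4
      \<and> (\<forall>i<N. \<forall>j<N. \<forall>t. \<bar>t\<bar> \<le> h \<longrightarrow> reg_disc r N (A((i, j) := A (i, j) + t)) - reg_disc r N A \<le> h * w i)"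
proof -
  have r1: "1 \<le> r" using r by simp
  obtain h\<^sub>0 where h0: "h\<^sub>0 > 0"
    and W: "\<And>h v. 0 < h \<Longrightarrow> h \<le> h\<^sub>0 \<Longrightarrow> (\<Sum>i<N. ((\<bar>v i\<bar> + h) / reg_norm r N v) powr r) \<le> 2"
    using reg_norm_weights_sum[OF r1, of N] by metis
  have "\<exists>w. (\<forall>i. 0 \<le> w i) \<and> (\<Sum>i<N. w i) \<le> 3 * real N powr (1 / r)
      \<and> (\<Sum>i<N. (w i)\<^sup>2) \<le> 4
      \<and> (\<forall>i<N. \<forall>j<N. \<forall>t. \<bar>t\<bar> \<le> h \<longrightarrow> reg_disc r N (A((i, j) := A (i, j) + t)) - reg_disc r N A \<le> h * w i)"
    if h: "0 < h" "h \<le> h\<^sub>0" for h A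
  proof -
    have "reg_disc r N A \<in> (\<lambda>\<sigma>. reg_norm r N (mat_act N A \<sigma>)) ` sign_vecs N"
      unfolding reg_disc_def using finite_sign_vecs sign_vecs_nonempty by (intro Min_in) auto
    then obtain \<sigma> where s: "\<sigma> \<in> sign_vecs N" "reg_disc r N A = reg_norm r N (mat_act N A \<sigma>)" by auto
    define v where "v = mat_act N A \<sigma>"
    define w where "w = (\<lambda>i. ((\<bar>v i\<bar> + h) / reg_norm r N v) powr (r - 1))"
    have g: "reg_norm r N v \<ge> 1" using r by (intro reg_norm_ge_1) auto
    have step: "reg_disc r N (A((i, j) := A (i, j) + t)) - reg_disc r N A \<le> h * w i"
      if ij: "i < N" "j < N" and t: "\<bar>t\<bar> \<le> h" for i j t
    proof -
      let ?A = "A((i, j) := A (i, j) + t)"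
      have act: "mat_act N ?A \<sigma> = v(i := v i + t * \<sigma> $ j)"
      proof
        fix k
        have "mat_act N ?A \<sigma> k = (\<Sum>l<N. A (k, l) * \<sigma> $ l + (if k = i \<and> l = j then t * \<sigma> $ j else 0))"
          unfolding mat_act_def by (intro sum.cong) (auto simp: algebra_simps)
        also have "\<dots> = v k + (if k = i then t * \<sigma> $ j else 0)"
          using ij by (simp add: sum.distrib v_def mat_act_def)
        finally show "mat_act N ?A \<sigma> k = (v(i := v i + t * \<sigma> $ j)) k" by simp
      qed
      have "reg_disc r N ?A \<le> reg_norm r N (mat_act N ?A \<sigma>)"
        unfolding reg_disc_def using finite_sign_vecs s by (intro Min_le) auto
      moreover have "reg_norm r N (v(i := v i + t * \<sigma> $ j)) - reg_norm r N v \<le> h * w i"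
        unfolding w_def using r1 ij t sign_vecs_abs[OF s(1) ij(2)]
        by (intro reg_norm_upd_le_weight) (auto simp: abs_mult)
      ultimately show ?thesis unfolding act s(2) v_def by linarith
    qed
    have a: "0 \<le> (\<bar>v i\<bar> + h) / reg_norm r N v" for i using g h by auto
    show ?thesis
      using weights_L1_L2[OF r a W[OF h]] step by (intro exI[of _ w]) (auto simp: w_def)
  qed
  with h0 show thesis by (rule that)
qed

lemma reg_disc_permute_rows:
  assumes "bij_betw \<pi> {..<N} {..<N}"
  shows "reg_disc r N (\<lambda>(i, j). A (\<pi> i, j)) = reg_disc r N A"
proof -
  have "reg_norm r N (mat_act N (\<lambda>(i, j). A (\<pi> i, j)) \<sigma>) = reg_norm r N (mat_act N A \<sigma>)" for \<sigma>
    using sum.reindex_bij_betw[OF assms, of "\<lambda>i. \<bar>mat_act N A \<sigma> i\<bar> powr r"]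
    by (simp add: reg_norm_def mat_act_def)
  then show ?thesis by (simp add: reg_disc_def)
qed

section \<open>The variance of the regularised discrepancy of a cube matrix\<close>

text \<open>Each entry \<open>p\<close> of the matrix is a normalised sum of the \<open>m\<close> signs indexed by \<open>(p, k)\<close>.\<close>

definition rad_sum :: "nat \<Rightarrow> ('p \<times> nat) set \<Rightarrow> 'p \<Rightarrow> real" where
  "rad_sum m S p = (\<Sum>k<m. if (p, k) \<in> S then 1 else - 1) / sqrt (real m)"

lemma rad_sum_insert:
  assumes "k < m"
  shows "rad_sum m (insert (p, k) S) = (rad_sum m S)(p := rad_sum m S p + (if (p, k) \<in> S then 0 else 2 / sqrt (real m)))"
proof
  fix q
  have "rad_sum m (insert (p, k) S) q
      = (\<Sum>l<m. (if (q, l) \<in> S then 1 else - 1) + (if l = k \<and> q = p \<and> (p, k) \<notin> S then 2 else 0)) / sqrt (real m)"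
    unfolding rad_sum_def by (intro arg_cong2[where f="(/)"] sum.cong) auto
  also have "\<dots> = rad_sum m S q + (if q = p \<and> (p, k) \<notin> S then 2 / sqrt (real m) else 0)"
    using assms by (cases "q = p"; cases "(p, k) \<in> S") (simp_all add: sum.distrib rad_sum_def add_divide_distrib diff_divide_distrib)
  finally show "rad_sum m (insert (p, k) S) q
      = ((rad_sum m S)(p := rad_sum m S p + (if (p, k) \<in> S then 0 else 2 / sqrt (real m)))) q"
    by simp
qed

lemma rad_sum_delete:
  assumes "k < m"
  shows "rad_sum m (S - {(p, k)}) = (rad_sum m S)(p := rad_sum m S p + (if (p, k) \<in> S then - 2 / sqrt (real m) else 0))"
proof
  fix q
  have "rad_sum m (S - {(p, k)}) q
      = (\<Sum>l<m. (if (q, l) \<in> S then 1 else - 1) + (if l = k \<and> q = p \<and> (p, k) \<in> S then - 2 else 0)) / sqrt (real m)"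
    unfolding rad_sum_def by (intro arg_cong2[where f="(/)"] sum.cong) auto
  also have "\<dots> = rad_sum m S q + (if q = p \<and> (p, k) \<in> S then - 2 / sqrt (real m) else 0)"
    using assms by (cases "q = p"; cases "(p, k) \<in> S") (simp_all add: sum.distrib rad_sum_def add_divide_distrib diff_divide_distrib)
  finally show "rad_sum m (S - {(p, k)}) q
      = ((rad_sum m S)(p := rad_sum m S p + (if (p, k) \<in> S then - 2 / sqrt (real m) else 0))) q"
    by simp
qed

text \<open>The discrepancy does not change when rows are permuted, so all rows have the same influence.
  The weights only bound the sum of the influences over the rows; symmetry shares it equally.\<close>

lemma flip_diff_row_symmetric:
  fixes r :: real
  defines "f \<equiv> \<lambda>m N S. reg_disc r N (rad_sum m S)"
  assumes "i < N" "i' < N"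
  shows "cube_avg (({..<N} \<times> {..<N}) \<times> {..<m}) (\<lambda>S. \<bar>flip_diff ((i, j), k) (f m N) S\<bar>)
    = cube_avg (({..<N} \<times> {..<N}) \<times> {..<m}) (\<lambda>S. \<bar>flip_diff ((i', j), k) (f m N) S\<bar>)"
proof -
  define \<pi> where "\<pi> = Transposition.transpose i i'"
  define P where "P = (\<lambda>((a, j), k). ((\<pi> a, j :: nat), k :: nat))"
  let ?I = "({..<N} \<times> {..<N}) \<times> {..<m}"
  have pi: "bij_betw \<pi> {..<N} {..<N}" "\<pi> (\<pi> a) = a" for a
    using assms by (auto simp: \<pi>_def intro!: bij_betw_byWitness[where f'="\<pi>"])
  have PP: "P (P x) = x" for x using pi(2) by (auto simp: P_def split: prod.splits)
  have PI: "P x \<in> ?I" if "x \<in> ?I" for x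
    using that pi(1) by (auto simp: P_def bij_betw_def)
  have bij: "bij_betw P ?I ?I"
  proof (rule bij_betw_byWitness[where f'=P])
    show "P ` ?I \<subseteq> ?I" "P ` ?I \<subseteq> ?I" using PI by blast+
  qed (use PP in blast)+
  have injP: "inj P" using PP by (metis injI)
  have mem: "x \<in> P ` S \<longleftrightarrow> P x \<in> S" for x S
    using PP by (metis image_iff)
  have inv: "f m N (P ` S) = f m N S" for S
  proof -
    have "rad_sum m (P ` S) = (\<lambda>(a, b). rad_sum m S (\<pi> a, b))"
      by (auto simp: fun_eq_iff rad_sum_def mem) (simp add: P_def)
    then show ?thesis
      using reg_disc_permute_rows[OF pi(1), of r "rad_sum m S"] by (simp add: f_def)
  qed
  have "flip_diff ((i', j), k) (f m N) (P ` S) = flip_diff ((i, j), k) (f m N) S" for S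
  proof -
    have e: "((i', j), k) = P ((i, j), k)" by (simp add: P_def \<pi>_def)
    have "insert ((i', j), k) (P ` S) = P ` (insert ((i, j), k) S)" by (simp add: e)
    moreover have "P ` S - {((i', j), k)} = P ` (S - {((i, j), k)})"
      unfolding e using injP by (simp add: image_set_diff)
    ultimately show ?thesis unfolding flip_diff_def by (simp only: inv)
  qed
  then show ?thesis
    using cube_avg_permute[OF bij, of "\<lambda>S. \<bar>flip_diff ((i', j), k) (f m N) S\<bar>"] by simp
qed

text \<open>The energy is at most \<open>32 N\<close>, and the squared influences add up to at most \<open>144 N powr (2 / r)\<close>.
  The value \<open>L = (1 - 2 / r) * ln N\<close> makes \<open>exp L * N powr (2 / r)\<close> equal to \<open>N\<close>, so that both
  terms of the \<open>L\<^sup>1\<close>-\<open>L\<^sup>2\<close> inequality are of order \<open>N\<close>. The condition on \<open>m\<close> makes the step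
  \<open>2 / sqrt m\<close> of a flip small enough for the weights to be controlled.\<close>

lemma cube_variance_reg_disc:
  fixes r :: real
  assumes r: "2 \<le> r" and N: "0 < N"
  shows "\<forall>\<^sub>F m in sequentially.
    (1 + (1 - 2 / r) * ln (real N)) *
      (cube_avg (({..<N} \<times> {..<N}) \<times> {..<m}) (\<lambda>S. (reg_disc r N (rad_sum m S))\<^sup>2)
       - (cube_avg (({..<N} \<times> {..<N}) \<times> {..<m}) (\<lambda>S. reg_disc r N (rad_sum m S)))\<^sup>2)
    \<le> 176 * real N"
proof -
  obtain h\<^sub>0 where h0: "h\<^sub>0 > 0"
    and W: "\<And>h A. 0 < h \<Longrightarrow> h \<le> h\<^sub>0 \<Longrightarrow> \<exists>w. (\<forall>i. 0 \<le> w i) \<and> (\<Sum>i<N. w i) \<le> 3 * real N powr (1 / r)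
      \<and> (\<Sum>i<N. (w i)\<^sup>2) \<le> 4
      \<and> (\<forall>i<N. \<forall>j<N. \<forall>t. \<bar>t\<bar> \<le> h \<longrightarrow> reg_disc r N (A((i, j) := A (i, j) + t)) - reg_disc r N A \<le> h * w i)"
    using reg_disc_one_sided[OF r, of N] by metis
  have "\<forall>\<^sub>F m in sequentially. 2 / sqrt (real m) < h\<^sub>0"
    using h0 by real_asymp
  then show ?thesis
    using eventually_gt_at_top[of 0]
  proof eventually_elim
    case (elim m)
    define h where "h = 2 / sqrt (real m)"
    have h: "0 < h" "h \<le> h\<^sub>0" and h2: "h\<^sup>2 = 4 / real m"
      using elim by (auto simp: h_def power_divide)
    define I where "I = ({..<N} \<times> {..<N}) \<times> {..<m}"
    define f where "f = (\<lambda>S. reg_disc r N (rad_sum m S))"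
    have finI: "finite I" by (simp add: I_def)
    obtain w where w0: "\<And>A i. 0 \<le> w A i" and w1: "\<And>A. (\<Sum>i<N. w A i) \<le> 3 * real N powr (1 / r)"
      and w2: "\<And>A. (\<Sum>i<N. (w A i)\<^sup>2) \<le> 4"
      and w3: "\<And>A i j t. i < N \<Longrightarrow> j < N \<Longrightarrow> \<bar>t\<bar> \<le> h \<Longrightarrow>
        reg_disc r N (A((i, j) := A (i, j) + t)) - reg_disc r N A \<le> h * w A i"
      using W[OF h] by metis
    define u where "u = (\<lambda>i S. h * w (rad_sum m S) i)"
    have u0: "0 \<le> u i S" for i S using w0 h by (simp add: u_def)
    have one: "cube_avg I (\<lambda>S. \<bar>flip_diff ((i, j), k) f S\<bar> ^ p) \<le> 2 * cube_avg I (\<lambda>S. u i S ^ p)"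
      if "i < N" "j < N" "k < m" "p > 0" for i j k p
    proof (rule flip_diff_one_sided)
      show "f (insert ((i, j), k) S) - f S \<le> u i S" for S
        using that h unfolding f_def u_def rad_sum_insert[OF \<open>k < m\<close>] by (intro w3) (auto simp: h_def)
      show "f (S - {((i, j), k)}) - f S \<le> u i S" for S
        using that h unfolding f_def u_def rad_sum_delete[OF \<open>k < m\<close>] by (intro w3) (auto simp: h_def)
    qed (use that u0 finI in \<open>auto simp: I_def\<close>)
    have "(\<Sum>i<N. cube_avg I (\<lambda>S. (flip_diff ((i, j), k) f S)\<^sup>2)) \<le> 32 / real m"
      if "j < N" "k < m" for j k
    proof -
      have "(\<Sum>i<N. cube_avg I (\<lambda>S. (flip_diff ((i, j), k) f S)\<^sup>2)) \<le> (\<Sum>i<N. 2 * cube_avg I (\<lambda>S. (u i S)\<^sup>2))"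
        using one[OF _ that, of _ 2] by (intro sum_mono) auto
      also have "\<dots> = 2 * cube_avg I (\<lambda>S. \<Sum>i<N. (u i S)\<^sup>2)"
        by (simp add: cube_avg_sum sum_distrib_left)
      also have "\<dots> \<le> 2 * cube_avg I (\<lambda>S. h\<^sup>2 * 4)"
        unfolding u_def power_mult_distrib sum_distrib_left[symmetric]
        by (intro mult_left_mono cube_avg_mono w2) auto
      also have "\<dots> = 32 / real m" using finI by (simp add: cube_avg_const h2)
      finally show ?thesis .
    qed
    then have "(\<Sum>j<N. \<Sum>k<m. \<Sum>i<N. cube_avg I (\<lambda>S. (flip_diff ((i, j), k) f S)\<^sup>2)) \<le> (\<Sum>j<N. \<Sum>k<m. 32 / real m)"
      by (intro sum_mono) auto
    also have "\<dots> = 32 * real N" using elim by simp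
    also have "(\<Sum>j<N. \<Sum>k<m. \<Sum>i<N. cube_avg I (\<lambda>S. (flip_diff ((i, j), k) f S)\<^sup>2))
        = (\<Sum>e\<in>I. cube_avg I (\<lambda>S. (flip_diff e f S)\<^sup>2))"
      (is "?l = _")
    proof -
      have "?l = (\<Sum>j<N. \<Sum>i<N. \<Sum>k<m. cube_avg I (\<lambda>S. (flip_diff ((i, j), k) f S)\<^sup>2))"
        by (intro sum.cong refl sum.swap)
      also have "\<dots> = (\<Sum>i<N. \<Sum>j<N. \<Sum>k<m. cube_avg I (\<lambda>S. (flip_diff ((i, j), k) f S)\<^sup>2))"
        by (rule sum.swap)
      finally show ?thesis by (simp add: I_def sum.cartesian_product')
    qed
    finally have energy: "(\<Sum>e\<in>I. cube_avg I (\<lambda>S. (flip_diff e f S)\<^sup>2)) \<le> 32 * real N" .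
    have infl: "(cube_avg I (\<lambda>S. \<bar>flip_diff ((i, j), k) f S\<bar>))\<^sup>2 \<le> 144 / real m * real N powr (2 / r) / (real N)\<^sup>2"
      if ij: "i < N" "j < N" "k < m" for i j k
    proof -
      let ?a = "cube_avg I (\<lambda>S. \<bar>flip_diff ((i, j), k) f S\<bar>)"
      have "real N * ?a = (\<Sum>i'<N. ?a)" by simp
      also have "\<dots> = (\<Sum>i'<N. cube_avg I (\<lambda>S. \<bar>flip_diff ((i', j), k) f S\<bar>))"
        using ij unfolding I_def f_def by (intro sum.cong flip_diff_row_symmetric) auto
      also have "\<dots> \<le> (\<Sum>i'<N. 2 * cube_avg I (u i'))"
        using one[OF _ that(2,3), of _ 1] by (intro sum_mono) auto
      also have "\<dots> = 2 * cube_avg I (\<lambda>S. \<Sum>i<N. u i S)"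
        by (simp add: cube_avg_sum sum_distrib_left)
      also have "\<dots> \<le> 2 * cube_avg I (\<lambda>S. h * (3 * real N powr (1 / r)))"
        unfolding u_def sum_distrib_left[symmetric]
        using h by (intro mult_left_mono cube_avg_mono w1) auto
      also have "\<dots> = 6 * h * real N powr (1 / r)" using finI by (simp add: cube_avg_const)
      finally have "?a \<le> 6 * h * real N powr (1 / r) / real N"
        using N by (simp add: pos_le_divide_eq mult.commute)
      moreover have "0 \<le> ?a" by (intro cube_avg_nonneg) auto
      ultimately have "?a\<^sup>2 \<le> (6 * h * real N powr (1 / r) / real N)\<^sup>2" by (intro power_mono)
      also have "\<dots> = 144 / real m * real N powr (2 / r) / (real N)\<^sup>2"
        by (simp add: power_divide power_mult_distrib h2)
          (simp add: power2_eq_square powr_add[symmetric])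
      finally show ?thesis .
    qed
    have "(\<Sum>e\<in>I. (cube_avg I (\<lambda>S. \<bar>flip_diff e f S\<bar>))\<^sup>2)
        \<le> (\<Sum>e\<in>I. 144 / real m * real N powr (2 / r) / (real N)\<^sup>2)"
      using infl by (intro sum_mono) (auto simp: I_def)
    also have "\<dots> = 144 * real N powr (2 / r)"
      using N elim by (simp add: I_def card_cartesian_product power2_eq_square)
    finally have L1: "(\<Sum>e\<in>I. (cube_avg I (\<lambda>S. \<bar>flip_diff e f S\<bar>))\<^sup>2) \<le> 144 * real N powr (2 / r)" .
    define L where "L = (1 - 2 / r) * ln (real N)"
    have expL: "exp L * real N powr (2 / r) = real N"
      using N by (simp add: L_def powr_def exp_add[symmetric] algebra_simps)
    have "(L + 1) * (cube_avg I (\<lambda>S. (f S)\<^sup>2) - (cube_avg I f)\<^sup>2)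
        \<le> 32 * real N + exp L * (144 * real N powr (2 / r))"
      by (intro order_trans[OF cube_variance_L1_L2[OF finI]] add_mono energy mult_left_mono L1) auto
    also have "\<dots> = 176 * real N" using expL by (simp add: mult.left_commute[of _ 144])
    finally show ?case by (simp add: L_def f_def I_def add.commute)
  qed
qed

section \<open>From the cube to Gaussian variables\<close>

text \<open>The uniform distribution on the cube, written as a product so that independence of the
  coordinates is available.\<close>

definition fair_coins :: "'i set \<Rightarrow> ('i \<Rightarrow> bool) pmf" where
  "fair_coins I = Pi_pmf I False (\<lambda>_. bernoulli_pmf (1 / 2))"

lemma cube_avg_eq_expectation:
  assumes "finite I"
  shows "cube_avg I f = measure_pmf.expectation (fair_coins I) (\<lambda>\<omega>. f {x\<in>I. \<omega> x})"
proof -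
  have "cube_avg I f = measure_pmf.expectation (pmf_of_set (Pow I)) f"
    using assms by (subst integral_pmf_of_set) (auto simp: cube_avg_def card_Pow)
  also have "pmf_of_set (Pow I) = map_pmf (\<lambda>\<omega>. {x\<in>I. \<omega> x}) (fair_coins I)"
    using assms by (simp add: fair_coins_def pmf_of_set_Pow_conv_bernoulli)
  finally show ?thesis by simp
qed

definition coin_sum :: "nat \<Rightarrow> 'p \<Rightarrow> ('p \<times> nat \<Rightarrow> bool) \<Rightarrow> real" where
  "coin_sum m p \<omega> = (\<Sum>k<m. (if \<omega> (p, k) then 1 else - 1) / sqrt (real m))"

lemma rad_sum_eq_coin_sum:
  "p \<in> J \<Longrightarrow> rad_sum m {x \<in> J \<times> {..<m}. \<omega> x} p = coin_sum m p \<omega>"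
  by (simp add: rad_sum_def coin_sum_def sum_divide_distrib)

lemma indep_coins:
  assumes "finite I"
  shows "prob_space.indep_vars (measure_pmf (fair_coins I)) (\<lambda>_. count_space UNIV) (\<lambda>x \<omega>. \<omega> x) I"
  unfolding fair_coins_def using assms by (rule indep_vars_Pi_pmf)

lemma indep_coin_sums:
  fixes J :: "'p set"
  assumes "finite J"
  shows "prob_space.indep_vars (measure_pmf (fair_coins (J \<times> {..<m}))) (\<lambda>_. borel) (coin_sum m) J"
proof -
  define K :: "'p \<Rightarrow> ('p \<times> nat) set" where "K = (\<lambda>p. {p} \<times> {..<m})"
  define Y :: "'p \<Rightarrow> ('p \<times> nat \<Rightarrow> bool) \<Rightarrow> real"
    where "Y = (\<lambda>p g. \<Sum>k<m. (if g (p, k) then 1 else - 1) / sqrt (real m))"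
  have "prob_space.indep_vars (measure_pmf (fair_coins (J \<times> {..<m}))) (\<lambda>p. PiM (K p) (\<lambda>_. count_space UNIV)) (\<lambda>p \<omega>. restrict (\<lambda>x. \<omega> x) (K p)) J"
    by (rule prob_space.indep_vars_restrict[OF measure_pmf.prob_space_axioms indep_coins]) (use assms in \<open>auto simp: K_def disjoint_family_on_def\<close>)
  moreover have "Y p \<in> borel_measurable (PiM (K p) (\<lambda>_. count_space UNIV))" for p
    unfolding Y_def
  proof (intro borel_measurable_sum)
    fix k assume "k \<in> {..<m}"
    then have [measurable]: "(\<lambda>g. g (p, k)) \<in> measurable (PiM (K p) (\<lambda>_. count_space UNIV)) (count_space UNIV)"
      by (intro measurable_component_singleton) (auto simp: K_def)
    show "(\<lambda>g. (if g (p, k) then 1 else - 1) / sqrt (real m)) \<in> borel_measurable (PiM (K p) (\<lambda>_. count_space UNIV))"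
      by measurable
  qed
  ultimately have "prob_space.indep_vars (measure_pmf (fair_coins (J \<times> {..<m}))) (\<lambda>_. borel) (\<lambda>p \<omega>. Y p (restrict (\<lambda>x. \<omega> x) (K p))) J"
    by (rule prob_space.indep_vars_compose2[OF measure_pmf.prob_space_axioms])
  moreover have "Y p (restrict (\<lambda>x. \<omega> x) (K p)) = coin_sum m p \<omega>" for p \<omega>
    by (simp add: Y_def K_def coin_sum_def)
  ultimately show ?thesis by simp
qed

lemma char_coin_sum:
  assumes "finite J" "p \<in> J"
  shows "char (distr (measure_pmf (fair_coins (J \<times> {..<m}))) borel (coin_sum m p)) t
    = of_real (cos (t / sqrt (real m)) ^ m)"
proof -
  let ?I = "J \<times> {..<m}"
  let ?P = "measure_pmf (fair_coins ?I)"
  let ?\<epsilon> = "\<lambda>b. (if b then 1 else - 1) / sqrt (real m)"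
  have finI: "finite ?I" using assms by simp
  have ind: "prob_space.indep_vars (measure_pmf (fair_coins (J \<times> {..<m}))) (\<lambda>_. borel) (\<lambda>x \<omega>. ?\<epsilon> (\<omega> x)) ({p} \<times> {..<m})"
    by (rule prob_space.indep_vars_compose2[OF measure_pmf.prob_space_axioms prob_space.indep_vars_subset[OF measure_pmf.prob_space_axioms indep_coins[OF finI]]])
      (use assms in auto)
  have one: "char (distr ?P borel (\<lambda>\<omega>. ?\<epsilon> (\<omega> x))) t = of_real (cos (t / sqrt (real m)))"
    if "x \<in> ?I" for x
  proof -
    have "char (distr ?P borel (\<lambda>\<omega>. ?\<epsilon> (\<omega> x))) t = (CLINT \<omega>|?P. iexp (t * ?\<epsilon> (\<omega> x)))"
      unfolding char_def by (subst integral_distr) auto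
    also have "\<dots> = (CLINT b|measure_pmf (map_pmf (\<lambda>\<omega>. \<omega> x) (fair_coins ?I)). iexp (t * ?\<epsilon> b))"
      by simp
    also have "map_pmf (\<lambda>\<omega>. \<omega> x) (fair_coins ?I) = bernoulli_pmf (1 / 2)"
      unfolding fair_coins_def using that by (subst Pi_pmf_component[OF finI]) auto
    also have "(CLINT b|measure_pmf (bernoulli_pmf (1 / 2)). iexp (t * ?\<epsilon> b))
        = (iexp (t / sqrt (real m)) + iexp (- t / sqrt (real m))) / 2"
      by (subst integral_measure_pmf[of UNIV]) (auto simp: UNIV_bool scaleR_conv_of_real field_simps)
    also have "\<dots> = of_real (cos (t / sqrt (real m)))"
      by (simp add: complex_eq_iff Re_exp Im_exp)
    finally show ?thesis .
  qed
  have "coin_sum m p = (\<lambda>\<omega>. \<Sum>x\<in>{p} \<times> {..<m}. ?\<epsilon> (\<omega> x))"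
    by (simp add: fun_eq_iff coin_sum_def sum.cartesian_product')
  then have "char (distr ?P borel (coin_sum m p)) t
      = (\<Prod>x\<in>{p} \<times> {..<m}. char (distr ?P borel (\<lambda>\<omega>. ?\<epsilon> (\<omega> x))) t)"
    using prob_space.char_distr_sum[OF measure_pmf.prob_space_axioms ind, of t] by simp
  also have "\<dots> = (\<Prod>x\<in>{p} \<times> {..<m}. of_real (cos (t / sqrt (real m))))"
    using assms by (intro prod.cong one) auto
  also have "\<dots> = of_real (cos (t / sqrt (real m)) ^ m)" by simp
  finally show ?thesis .
qed

definition coin_sum_law :: "nat \<Rightarrow> real measure" where
  "coin_sum_law m = distr (measure_pmf (fair_coins ({()} \<times> {..<m}))) borel (coin_sum m ())"

lemma real_distribution_coin_sum:
  "real_distribution (distr (measure_pmf (fair_coins I)) borel (coin_sum m p))"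
  by (intro prob_space.real_distribution_distr measure_pmf.prob_space_axioms) simp

lemma distr_coin_sum:
  assumes "finite J" "p \<in> J"
  shows "distr (measure_pmf (fair_coins (J \<times> {..<m}))) borel (coin_sum m p) = coin_sum_law m"
  unfolding coin_sum_law_def
  by (intro Levy_uniqueness real_distribution_coin_sum ext) (use assms in \<open>simp add: char_coin_sum\<close>)

lemma coin_sum_law_tendsto_normal: "weak_conv_m (\<lambda>n. coin_sum_law (Suc n)) std_normal_distribution"
proof (rule levy_continuity)
  show "real_distribution (coin_sum_law (Suc n))" for n
    unfolding coin_sum_law_def by (rule real_distribution_coin_sum)
  show "real_distribution std_normal_distribution" by (rule real_dist_normal_dist)
  fix t
  have "(\<lambda>n. cos (t / sqrt (real n)) ^ n) \<longlonglongrightarrow> exp (- (t * t / 2))" by real_asymp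
  then have "(\<lambda>n. cos (t / sqrt (real (Suc n))) ^ (Suc n)) \<longlonglongrightarrow> exp (- (t\<^sup>2 / 2))"
    unfolding power2_eq_square by (rule LIMSEQ_Suc)
  then have "(\<lambda>n. complex_of_real (cos (t / sqrt (real (Suc n))) ^ (Suc n))) \<longlonglongrightarrow> of_real (exp (- (t\<^sup>2 / 2)))"
    by (rule tendsto_of_real)
  moreover have "char (coin_sum_law (Suc n)) t = of_real (cos (t / sqrt (real (Suc n))) ^ (Suc n))" for n
    unfolding coin_sum_law_def by (rule char_coin_sum) auto
  ultimately show "(\<lambda>n. char (coin_sum_law (Suc n)) t) \<longlonglongrightarrow> char std_normal_distribution t"
    by (simp only: char_std_normal_distribution minus_divide_left)
qed

text \<open>The shift \<open>c\<close> makes the induction go through; the case \<open>c = 0\<close> is the variance of a sum of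
  independent signs.\<close>

lemma cube_avg_sum_signs_squared:
  assumes "finite I"
  shows "cube_avg I (\<lambda>S. (c + (\<Sum>x\<in>I. if x \<in> S then 1 else - 1))\<^sup>2) = c\<^sup>2 + real (card I)"
  using assms
proof (induction I arbitrary: c rule: finite_induct)
  case (insert a I)
  have A0: "cube_avg I (\<lambda>S. (c + (\<Sum>x\<in>insert a I. if x \<in> S then 1 else - 1))\<^sup>2)
      = cube_avg I (\<lambda>S. ((c - 1) + (\<Sum>x\<in>I. if x \<in> S then 1 else - 1))\<^sup>2)"
    using insert.hyps by (intro cube_avg_cong) (auto simp: algebra_simps)
  have A1: "cube_avg I (\<lambda>S. (c + (\<Sum>x\<in>insert a I. if x \<in> insert a S then 1 else - 1))\<^sup>2)
      = cube_avg I (\<lambda>S. ((c + 1) + (\<Sum>x\<in>I. if x \<in> S then 1 else - 1))\<^sup>2)"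
  proof (intro cube_avg_cong)
    fix S assume "S \<subseteq> I"
    have "(\<Sum>x\<in>I. if x \<in> insert a S then 1 else - 1 :: real) = (\<Sum>x\<in>I. if x \<in> S then 1 else - 1)"
      using insert.hyps by (intro sum.cong) auto
    then show "(c + (\<Sum>x\<in>insert a I. if x \<in> insert a S then 1 else - 1))\<^sup>2
        = ((c + 1) + (\<Sum>x\<in>I. if x \<in> S then 1 else - 1))\<^sup>2"
      using insert.hyps by (simp add: add.assoc)
  qed
  have "cube_avg (insert a I) (\<lambda>S. (c + (\<Sum>x\<in>insert a I. if x \<in> S then 1 else - 1))\<^sup>2)
      = (((c - 1)\<^sup>2 + real (card I)) + ((c + 1)\<^sup>2 + real (card I))) / 2"
    by (simp only: cube_avg_insert[OF insert.hyps] A0 A1 insert.IH)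
  also have "\<dots> = c\<^sup>2 + real (card (insert a I))"
    using insert.hyps by (simp add: power2_eq_square field_simps)
  finally show ?case .
qed simp

lemma coin_sum_law_second_moment:
  assumes "m > 0"
  shows "(\<integral>\<^sup>+x. ennreal (x\<^sup>2) \<partial>coin_sum_law m) = 1"
proof -
  let ?I = "{()} \<times> {..<m}"
  have "measure_pmf.expectation (fair_coins ?I) (\<lambda>\<omega>. (coin_sum m () \<omega>)\<^sup>2)
      = cube_avg ?I (\<lambda>S. (rad_sum m S ())\<^sup>2)"
    by (subst cube_avg_eq_expectation) (auto simp: rad_sum_eq_coin_sum)
  also have "\<dots> = cube_avg ?I (\<lambda>S. (0 + (\<Sum>x\<in>?I. if x \<in> S then 1 else - 1))\<^sup>2 / real m)"
    unfolding rad_sum_def sum.cartesian_product' by (simp add: power_divide)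
  also have "\<dots> = 1" unfolding cube_avg_divide
    by (subst cube_avg_sum_signs_squared) (use assms in \<open>auto simp: card_cartesian_product\<close>)
  finally have E: "measure_pmf.expectation (fair_coins ?I) (\<lambda>\<omega>. (coin_sum m () \<omega>)\<^sup>2) = 1" .
  have fin: "finite (set_pmf (fair_coins ?I))"
    unfolding fair_coins_def by (subst set_Pi_pmf) (auto intro!: finite_PiE_dflt)
  have "(\<integral>\<^sup>+x. ennreal (x\<^sup>2) \<partial>coin_sum_law m) = (\<integral>\<^sup>+\<omega>. ennreal ((coin_sum m () \<omega>)\<^sup>2) \<partial>measure_pmf (fair_coins ?I))"
    unfolding coin_sum_law_def by (subst nn_integral_distr) auto
  also have "\<dots> = ennreal (measure_pmf.expectation (fair_coins ?I) (\<lambda>\<omega>. (coin_sum m () \<omega>)\<^sup>2))"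
    by (intro nn_integral_eq_integral integrable_measure_pmf_finite fin) auto
  finally show ?thesis using E by simp
qed

text \<open>Pointwise convergence together with convergence of the norms gives convergence in \<open>L\<^sup>2\<close>. Scheffe's
  lemma is a statement about \<open>L\<^sup>1\<close>; it is applied to the signed squares \<open>y * \<bar>y\<bar>\<close>, whose distance
  dominates half of the squared distance.\<close>

lemma L2_tendsto_of_second_moments:
  fixes Y :: "nat \<Rightarrow> 'a \<Rightarrow> real"
  assumes [measurable]: "\<And>n. Y n \<in> borel_measurable M" "Z \<in> borel_measurable M"
    and lim: "\<And>x. x \<in> space M \<Longrightarrow> (\<lambda>n. Y n x) \<longlonglongrightarrow> Z x"
    and Y: "\<And>n. (\<integral>\<^sup>+x. ennreal ((Y n x)\<^sup>2) \<partial>M) = 1" and Z: "(\<integral>\<^sup>+x. ennreal ((Z x)\<^sup>2) \<partial>M) = 1"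
  shows "(\<lambda>n. \<integral>\<^sup>+x. ennreal ((Y n x - Z x)\<^sup>2) \<partial>M) \<longlonglongrightarrow> 0"
proof -
  let ?s = "\<lambda>y::real. y * \<bar>y\<bar>"
  have norm_s: "norm (?s y) = y\<^sup>2" for y by (simp add: abs_mult power2_eq_square)
  have le: "(y - z)\<^sup>2 \<le> 2 * norm (?s y - ?s z)" for y z :: real
  proof -
    have *: "(y - z)\<^sup>2 \<le> 2 * \<bar>?s y - ?s z\<bar>" if "z \<le> y" for y z :: real
    proof -
      have sq: "0 \<le> (y - z) * (y - z)" by simp
      consider "0 \<le> z" | "z < 0" "0 \<le> y" | "y < 0" using that by linarith
      then have "(y - z) * (y - z) \<le> 2 * (?s y - ?s z)"
      proof cases
        case 1
        then have "(y - z) * (y - z) \<le> (y - z) * (y + z)" using that by (intro mult_left_mono) auto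
        moreover have s: "?s y - ?s z = (y - z) * (y + z)" using 1 that by (simp add: algebra_simps)
        ultimately show ?thesis using sq unfolding s by linarith
      next
        case 2
        have "0 \<le> (y + z)\<^sup>2" by simp
        moreover have s: "?s y - ?s z = y * y + z * z" using 2 by simp
        ultimately show ?thesis unfolding s by (simp add: power2_eq_square algebra_simps)
      next
        case 3
        then have "(y - z) * (y - z) \<le> (y - z) * (- y - z)" using that by (intro mult_left_mono) auto
        moreover have s: "?s y - ?s z = (y - z) * (- y - z)" using 3 that by (simp add: algebra_simps)
        ultimately show ?thesis using sq unfolding s by linarith
      qed
      also have "\<dots> \<le> 2 * \<bar>?s y - ?s z\<bar>" by (intro mult_left_mono abs_ge_self) simp
      finally show ?thesis unfolding power2_eq_square .
    qed
    show ?thesis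
    proof (cases "z \<le> y")
      case False
      then show ?thesis using *[of y z] by (simp add: power2_commute abs_minus_commute)
    qed (simp add: *)
  qed
  have "(\<lambda>n. \<integral>\<^sup>+x. norm (?s (Y n x) - ?s (Z x)) \<partial>M) \<longlonglongrightarrow> 0"
  proof (rule Scheffe_lemma2)
    show "integrable M (\<lambda>x. ?s (Z x))"
      by (rule integrableI_bounded) (use Z in \<open>simp_all only: norm_s\<close>, simp_all)
    show "AE x in M. (\<lambda>n. ?s (Y n x)) \<longlonglongrightarrow> ?s (Z x)"
      using lim by (intro AE_I2 tendsto_mult tendsto_rabs) auto
    show "(\<integral>\<^sup>+ x. norm (?s (Y n x)) \<partial>M) \<le> (\<integral>\<^sup>+ x. norm (?s (Z x)) \<partial>M)" for n
      unfolding norm_s Y Z by simp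
  qed simp
  then have "(\<lambda>n. ennreal 2 * (\<integral>\<^sup>+x. norm (?s (Y n x) - ?s (Z x)) \<partial>M)) \<longlonglongrightarrow> ennreal 2 * 0"
    by (intro ennreal_tendsto_cmult) auto
  then have lim0: "(\<lambda>n. ennreal 2 * (\<integral>\<^sup>+x. norm (?s (Y n x) - ?s (Z x)) \<partial>M)) \<longlonglongrightarrow> 0" by simp
  have "(\<integral>\<^sup>+x. ennreal ((Y n x - Z x)\<^sup>2) \<partial>M) \<le> ennreal 2 * (\<integral>\<^sup>+x. norm (?s (Y n x) - ?s (Z x)) \<partial>M)" for n
  proof -
    have "(\<integral>\<^sup>+x. ennreal ((Y n x - Z x)\<^sup>2) \<partial>M) \<le> (\<integral>\<^sup>+x. ennreal 2 * norm (?s (Y n x) - ?s (Z x)) \<partial>M)"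
    proof (intro nn_integral_mono)
      fix x
      show "ennreal ((Y n x - Z x)\<^sup>2) \<le> ennreal 2 * ennreal (norm (?s (Y n x) - ?s (Z x)))"
        using ennreal_leI[OF le[of "Y n x" "Z x"]]
        by (simp only: ennreal_mult zero_le_numeral norm_ge_zero)
    qed
    also have "\<dots> = ennreal 2 * (\<integral>\<^sup>+x. norm (?s (Y n x) - ?s (Z x)) \<partial>M)"
      by (intro nn_integral_cmult) simp
    finally show ?thesis .
  qed
  then show ?thesis
    by (intro tendsto_sandwich[OF _ _ tendsto_const lim0]) auto
qed

text \<open>The mean of \<open>V\<close> is a competitor in the least squares problem that defines the variance of \<open>U\<close>.\<close>

lemma (in prob_space) variance_le_perturbed:
  fixes U V :: "'a \<Rightarrow> real"
  assumes [measurable]: "U \<in> borel_measurable M" "V \<in> borel_measurable M"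
    and U: "integrable M (\<lambda>x. (U x)\<^sup>2)" and V: "integrable M (\<lambda>x. (V x)\<^sup>2)"
  shows "variance U \<le> 2 * variance V + 2 * expectation (\<lambda>x. (U x - V x)\<^sup>2)"
    and "integrable M (\<lambda>x. (U x - V x)\<^sup>2)"
proof -
  have U1: "integrable M U" and V1: "integrable M V"
    using U V by (auto intro: square_integrable_imp_integrable)
  have sq: "(a - b)\<^sup>2 \<le> 2 * a\<^sup>2 + 2 * b\<^sup>2" for a b :: real
    using zero_le_power2[of "a + b"] by (simp add: power2_eq_square algebra_simps)
  show UV: "integrable M (\<lambda>x. (U x - V x)\<^sup>2)"
    by (rule Bochner_Integration.integrable_bound[of M "\<lambda>x. 2 * (U x)\<^sup>2 + 2 * (V x)\<^sup>2"])
      (use U V sq in auto)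
  define c where "c = expectation V"
  have Ic: "integrable M (\<lambda>x. (W x - c)\<^sup>2)" if "integrable M (\<lambda>x. (W x)\<^sup>2)" "integrable M W" for W
    unfolding power2_diff using that by auto
  have "expectation (\<lambda>x. (U x - c)\<^sup>2) = variance U + (expectation U - c)\<^sup>2"
    unfolding variance_eq[OF U1 U] power2_diff using U U1 by (simp add: prob_space)
      (simp add: power2_eq_square algebra_simps)
  then have "variance U \<le> expectation (\<lambda>x. (U x - c)\<^sup>2)" by simp
  also have "\<dots> \<le> expectation (\<lambda>x. 2 * (V x - c)\<^sup>2 + 2 * (U x - V x)\<^sup>2)"
  proof (intro integral_mono Ic U U1 Bochner_Integration.integrable_add integrable_mult_right V V1 UV)
    show "(U x - c)\<^sup>2 \<le> 2 * (V x - c)\<^sup>2 + 2 * (U x - V x)\<^sup>2" for x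
      using sq[of "V x - c" "V x - U x"] by (simp add: power2_commute)
  qed
  also have "\<dots> = 2 * variance V + 2 * expectation (\<lambda>x. (U x - V x)\<^sup>2)"
    using Ic[OF V V1] UV by (simp add: c_def)
  finally show "variance U \<le> 2 * variance V + 2 * expectation (\<lambda>x. (U x - V x)\<^sup>2)" .
qed

lemma lipschitz_diff_squared_le:
  fixes F :: "('p \<Rightarrow> real) \<Rightarrow> real"
  assumes Lip: "\<And>x y. F x \<le> F y + (\<Sum>p\<in>J. \<bar>x p - y p\<bar>)"
  shows "(F x - F y)\<^sup>2 \<le> real (card J) * (\<Sum>p\<in>J. (x p - y p)\<^sup>2)"
proof -
  have "\<bar>F x - F y\<bar> \<le> (\<Sum>p\<in>J. \<bar>x p - y p\<bar>)"
    using Lip[of x y] Lip[of y x] by (simp add: abs_minus_commute abs_le_iff)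
  then have "(F x - F y)\<^sup>2 \<le> (\<Sum>p\<in>J. \<bar>x p - y p\<bar>)\<^sup>2"
    by (metis abs_ge_zero power2_abs power_mono)
  also have "\<dots> \<le> (\<Sum>p\<in>J. \<bar>x p - y p\<bar>\<^sup>2) * real (card J)"
    by (rule sum_squared_le_sum_of_squares)
  finally show ?thesis by (simp add: mult.commute)
qed

lemma (in prob_space) lipschitz_square_integrable:
  fixes F :: "('p \<Rightarrow> real) \<Rightarrow> real"
  assumes fin: "finite J" and [measurable]: "F \<in> borel_measurable (PiM J (\<lambda>_. borel))"
    and Lip: "\<And>x y. F x \<le> F y + (\<Sum>p\<in>J. \<bar>x p - y p\<bar>)"
    and [measurable]: "\<And>p. p \<in> J \<Longrightarrow> W p \<in> borel_measurable M"
    and W: "\<And>p. p \<in> J \<Longrightarrow> integrable M (\<lambda>x. (W p x)\<^sup>2)"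
  shows "integrable M (\<lambda>x. (F (\<lambda>p\<in>J. W p x))\<^sup>2)" "(\<lambda>x. F (\<lambda>p\<in>J. W p x)) \<in> borel_measurable M"
proof -
  show [measurable]: "(\<lambda>x. F (\<lambda>p\<in>J. W p x)) \<in> borel_measurable M" by measurable
  let ?z = "\<lambda>_. 0 :: real"
  have "(F w)\<^sup>2 \<le> 2 * (F ?z)\<^sup>2 + 2 * (real (card J) * (\<Sum>p\<in>J. (w p)\<^sup>2))" for w
  proof -
    have "0 \<le> (F w - 2 * F ?z)\<^sup>2" by simp
    then have "(F w)\<^sup>2 \<le> 2 * (F ?z)\<^sup>2 + 2 * (F w - F ?z)\<^sup>2"
      by (simp add: power2_eq_square algebra_simps)
    also have "(F w - F ?z)\<^sup>2 \<le> real (card J) * (\<Sum>p\<in>J. (w p)\<^sup>2)"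
      using lipschitz_diff_squared_le[of F J w ?z] Lip by simp
    finally show ?thesis by simp
  qed
  note bound = this[of "\<lambda>p\<in>J. W p _"]
  show "integrable M (\<lambda>x. (F (\<lambda>p\<in>J. W p x))\<^sup>2)"
  proof (rule Bochner_Integration.integrable_bound)
    show "integrable M (\<lambda>x. 2 * (F ?z)\<^sup>2 + 2 * (real (card J) * (\<Sum>p\<in>J. (W p x)\<^sup>2)))"
      using W by auto
    show "AE x in M. norm ((F (\<lambda>p\<in>J. W p x))\<^sup>2) \<le> norm (2 * (F ?z)\<^sup>2 + 2 * (real (card J) * (\<Sum>p\<in>J. (W p x)\<^sup>2)))"
    proof (rule AE_I2)
      fix x
      have "(\<Sum>p\<in>J. ((\<lambda>p\<in>J. W p x) p)\<^sup>2) = (\<Sum>p\<in>J. (W p x)\<^sup>2)" by (intro sum.cong) auto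
      then have "(F (\<lambda>p\<in>J. W p x))\<^sup>2 \<le> 2 * (F ?z)\<^sup>2 + 2 * (real (card J) * (\<Sum>p\<in>J. (W p x)\<^sup>2))"
        using bound[of x] by simp
      then show "norm ((F (\<lambda>p\<in>J. W p x))\<^sup>2) \<le> norm (2 * (F ?z)\<^sup>2 + 2 * (real (card J) * (\<Sum>p\<in>J. (W p x)\<^sup>2)))"
        by simp
    qed
  qed simp
qed

text \<open>The theorem on images of product measures asks for probability spaces as targets; the Dirac measure
  at 0 serves as one with the Borel sets.\<close>

lemma integral_PiM_distr:
  fixes h :: "('p \<Rightarrow> real) \<Rightarrow> real" and Y :: "'a \<Rightarrow> real"
  assumes "finite J" "prob_space \<Omega>" "Y \<in> borel_measurable \<Omega>"
    and [measurable]: "h \<in> borel_measurable (PiM J (\<lambda>_. borel))"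
  shows "(\<integral>x. h x \<partial>PiM J (\<lambda>_. distr \<Omega> borel Y)) = (\<integral>\<omega>. h (\<lambda>p\<in>J. Y (\<omega> p)) \<partial>PiM J (\<lambda>_. \<Omega>))"
proof -
  have ps: "prob_space (return borel (0::real))" by (rule prob_space_return) simp
  have Y: "Y \<in> measurable \<Omega> (return borel 0)" using assms(3) by simp
  have Ymeas: "compose J Y \<in> measurable (PiM J (\<lambda>_. \<Omega>)) (PiM J (\<lambda>_. borel))"
    unfolding compose_def using assms(3) by (intro measurable_restrict) (auto intro: measurable_compose measurable_component_singleton)
  have "distr (PiM J (\<lambda>_. \<Omega>)) (PiM J (\<lambda>_. return borel 0)) (compose J Y) = PiM J (\<lambda>_. distr \<Omega> (return borel 0) Y)"
    by (rule distr_PiM_finite_prob_space') (use assms ps Y in auto)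
  moreover have "distr \<Omega> (return borel 0) Y = distr \<Omega> borel Y" by (intro distr_cong) auto
  moreover have "distr (PiM J (\<lambda>_. \<Omega>)) (PiM J (\<lambda>_. return borel 0)) (compose J Y)
      = distr (PiM J (\<lambda>_. \<Omega>)) (PiM J (\<lambda>_. borel)) (compose J Y)"
    by (intro distr_cong sets_PiM_cong) auto
  ultimately have "PiM J (\<lambda>_. distr \<Omega> borel Y) = distr (PiM J (\<lambda>_. \<Omega>)) (PiM J (\<lambda>_. borel)) (compose J Y)"
    by simp
  then have "(\<integral>x. h x \<partial>PiM J (\<lambda>_. distr \<Omega> borel Y)) = (\<integral>\<omega>. h (compose J Y \<omega>) \<partial>PiM J (\<lambda>_. \<Omega>))"
    using Ymeas by (simp add: integral_distr)
  then show ?thesis by (simp add: compose_def)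
qed

lemma integral_coin_sum_laws:
  fixes h :: "('p \<Rightarrow> real) \<Rightarrow> real"
  assumes J: "finite J" "J \<noteq> {}" and [measurable]: "h \<in> borel_measurable (PiM J (\<lambda>_. borel))"
    and restr: "\<And>x. h (restrict x J) = h x"
  shows "(\<integral>x. h x \<partial>PiM J (\<lambda>_. coin_sum_law m)) = cube_avg (J \<times> {..<m}) (\<lambda>S. h (rad_sum m S))"
proof -
  let ?P = "measure_pmf (fair_coins (J \<times> {..<m}))"
  have m: "(\<lambda>\<omega>. \<lambda>p\<in>J. coin_sum m p \<omega>) \<in> measurable ?P (PiM J (\<lambda>_. borel))"
    by (intro measurable_restrict) simp
  have "PiM J (\<lambda>_. coin_sum_law m) = PiM J (\<lambda>p. distr ?P borel (coin_sum m p))"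
    using distr_coin_sum[OF J(1)] by (intro PiM_cong) auto
  also have "\<dots> = distr ?P (PiM J (\<lambda>_. borel)) (\<lambda>\<omega>. \<lambda>p\<in>J. coin_sum m p \<omega>)"
    by (rule prob_space.indep_vars_iff_distr_eq_PiM'[OF measure_pmf.prob_space_axioms J(2), THEN iffD1, symmetric])
      (auto intro: indep_coin_sums[OF J(1)])
  finally have E: "(\<integral>x. h x \<partial>PiM J (\<lambda>_. coin_sum_law m)) = (\<integral>\<omega>. h (\<lambda>p\<in>J. coin_sum m p \<omega>) \<partial>?P)"
    by (simp add: integral_distr[OF m])
  have "(\<lambda>p\<in>J. coin_sum m p \<omega>) = restrict (rad_sum m {x \<in> J \<times> {..<m}. \<omega> x}) J" for \<omega>
    by (simp add: fun_eq_iff rad_sum_eq_coin_sum restrict_def)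
  then show ?thesis
    using J by (simp only: E restr cube_avg_eq_expectation finite_cartesian_product finite_lessThan)
qed

text \<open>By the central limit theorem the normalised sums of signs converge in law to a standard normal
  variable. Skorohod's theorem realises this on one probability space with pointwise convergence,
  and since the second moments all equal 1, the convergence holds in \<open>L\<^sup>2\<close>. Taking independent
  copies for the entries \<open>p \<in> J\<close>, a Lipschitz function of the sums converges in \<open>L\<^sup>2\<close> to the same
  function of Gaussians. The factor 2 comes from the crude perturbation bound for variances.\<close>

theorem gaussian_variance_le_cube:
  fixes F :: "('p \<Rightarrow> real) \<Rightarrow> real" and J :: "'p set"
  defines "G \<equiv> PiM J (\<lambda>_. std_normal_distribution) :: ('p \<Rightarrow> real) measure"
  assumes J: "finite J" "J \<noteq> {}" and F[measurable]: "F \<in> borel_measurable (PiM J (\<lambda>_. borel))"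
    and Lip: "\<And>x y. F x \<le> F y + (\<Sum>p\<in>J. \<bar>x p - y p\<bar>)"
    and cube: "\<forall>\<^sub>F m in sequentially. cube_avg (J \<times> {..<m}) (\<lambda>S. (F (rad_sum m S))\<^sup>2)
      - (cube_avg (J \<times> {..<m}) (\<lambda>S. F (rad_sum m S)))\<^sup>2 \<le> B"
  shows "prob_space.variance G F \<le> 2 * B"
proof -
  have rd: "real_distribution (coin_sum_law (Suc n))" for n
    unfolding coin_sum_law_def by (rule real_distribution_coin_sum)
  obtain \<Omega> :: "real measure" and Y :: "nat \<Rightarrow> real \<Rightarrow> real" and Z :: "real \<Rightarrow> real"
    where sk: "prob_space \<Omega> \<and> (\<forall>n. Y n \<in> borel_measurable \<Omega>)
      \<and> (\<forall>n. distr \<Omega> borel (Y n) = coin_sum_law (Suc n)) \<and> Z \<in> measurable \<Omega> lborel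
      \<and> distr \<Omega> borel Z = std_normal_distribution \<and> (\<forall>x\<in>space \<Omega>. (\<lambda>n. Y n x) \<longlonglongrightarrow> Z x)"
    using Skorohod[OF rd real_dist_normal_dist coin_sum_law_tendsto_normal] by blast
  then have Om: "prob_space \<Omega>" and Ym: "\<And>n. Y n \<in> borel_measurable \<Omega>"
    and Y: "\<And>n. distr \<Omega> borel (Y n) = coin_sum_law (Suc n)"
    and Zm: "Z \<in> borel_measurable \<Omega>" and Z: "distr \<Omega> borel Z = std_normal_distribution"
    and lim: "\<And>x. x \<in> space \<Omega> \<Longrightarrow> (\<lambda>n. Y n x) \<longlonglongrightarrow> Z x"
    by auto
  note [measurable] = Ym Zm
  define Q where "Q = PiM J (\<lambda>_. \<Omega>)"
  interpret Q: prob_space Q unfolding Q_def by (intro prob_space_PiM Om)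
  have comp: "(\<lambda>\<omega>. \<omega> p) \<in> measurable Q \<Omega>" if "p \<in> J" for p
    unfolding Q_def using that by (rule measurable_component_singleton)
  have marg: "distr Q \<Omega> (\<lambda>\<omega>. \<omega> p) = \<Omega>" if "p \<in> J" for p
    unfolding Q_def using that Om by (intro distr_PiM_component) auto
  have mom: "(\<integral>\<^sup>+x. ennreal ((Y n x)\<^sup>2) \<partial>\<Omega>) = 1" for n
    using coin_sum_law_second_moment[of "Suc n"] by (simp add: Y[symmetric] nn_integral_distr)
  have "(\<integral>\<^sup>+x. ennreal (x\<^sup>2) \<partial>std_normal_distribution) = ennreal (\<integral>x. x\<^sup>2 \<partial>std_normal_distribution)"
    by (intro nn_integral_eq_integral integrable_std_normal_distribution_moment) simp
  also have "\<dots> = 1" using std_normal_distribution_even_moments(1)[of 1] by simp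
  finally have momZ: "(\<integral>\<^sup>+x. ennreal ((Z x)\<^sup>2) \<partial>\<Omega>) = 1"
    by (simp add: Z[symmetric] nn_integral_distr)
  define e where "e = (\<lambda>n. \<integral>\<^sup>+x. ennreal ((Y n x - Z x)\<^sup>2) \<partial>\<Omega>)"
  have e: "e \<longlonglongrightarrow> 0"
    unfolding e_def by (rule L2_tendsto_of_second_moments[OF Ym Zm lim mom momZ])
  have coord: "(\<integral>\<^sup>+\<omega>. ennreal (g (\<omega> p)) \<partial>Q) = (\<integral>\<^sup>+x. ennreal (g x) \<partial>\<Omega>)"
    if "p \<in> J" and [measurable]: "g \<in> borel_measurable \<Omega>" for p g
    by (subst marg[OF that(1), symmetric], subst nn_integral_distr) (use comp that in auto)
  have sqi: "integrable Q (\<lambda>\<omega>. (g (\<omega> p))\<^sup>2)"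
    if p: "p \<in> J" and [measurable]: "g \<in> borel_measurable \<Omega>" and g: "(\<integral>\<^sup>+x. ennreal ((g x)\<^sup>2) \<partial>\<Omega>) = 1" for p g
  proof (rule integrableI_bounded)
    note [measurable] = comp[OF p]
    show "(\<lambda>\<omega>. (g (\<omega> p))\<^sup>2) \<in> borel_measurable Q" by measurable
    show "(\<integral>\<^sup>+ \<omega>. ennreal (norm ((g (\<omega> p))\<^sup>2)) \<partial>Q) < \<infinity>"
      using coord[OF p, of "\<lambda>x. (g x)\<^sup>2"] g by simp
  qed
  define U where "U = (\<lambda>\<omega>. F (\<lambda>p\<in>J. Z (\<omega> p)))"
  define V where "V = (\<lambda>n \<omega>. F (\<lambda>p\<in>J. Y n (\<omega> p)))"
  have cm: "(\<lambda>\<omega>. g (\<omega> p)) \<in> borel_measurable Q" if "p \<in> J" "g \<in> borel_measurable \<Omega>" for p and g :: "real \<Rightarrow> real"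
    using comp that by (auto intro: measurable_compose)
  have U: "integrable Q (\<lambda>\<omega>. (U \<omega>)\<^sup>2)" and Um[measurable]: "U \<in> borel_measurable Q"
    unfolding U_def
    by (rule Q.lipschitz_square_integrable[OF J(1) F Lip, of "\<lambda>p \<omega>. Z (\<omega> p)"];
        (rule cm[OF _ Zm] sqi[OF _ Zm momZ], assumption))+
  have V: "integrable Q (\<lambda>\<omega>. (V n \<omega>)\<^sup>2)" and Vm[measurable]: "V n \<in> borel_measurable Q" for n
    unfolding V_def
    by (rule Q.lipschitz_square_integrable[OF J(1) F Lip, of "\<lambda>p \<omega>. Y n (\<omega> p)"];
        (rule cm[OF _ Ym] sqi[OF _ Ym mom], assumption))+
  define D where "D = (\<lambda>n. Q.expectation (\<lambda>\<omega>. (U \<omega> - V n \<omega>)\<^sup>2))"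
  have D0: "D n \<ge> 0" for n unfolding D_def by simp
  have De: "ennreal (D n) \<le> ennreal ((real (card J))\<^sup>2) * e n" for n
  proof -
    have "ennreal (D n) = (\<integral>\<^sup>+\<omega>. ennreal ((U \<omega> - V n \<omega>)\<^sup>2) \<partial>Q)"
      unfolding D_def by (intro nn_integral_eq_integral[symmetric] Q.variance_le_perturbed(2) U V Um Vm) simp
    also have "\<dots> \<le> (\<integral>\<^sup>+\<omega>. (\<Sum>p\<in>J. ennreal (real (card J) * (Y n (\<omega> p) - Z (\<omega> p))\<^sup>2)) \<partial>Q)"
    proof (intro nn_integral_mono)
      fix \<omega>
      have "(U \<omega> - V n \<omega>)\<^sup>2 \<le> real (card J) * (\<Sum>p\<in>J. ((\<lambda>p\<in>J. Z (\<omega> p)) p - (\<lambda>p\<in>J. Y n (\<omega> p)) p)\<^sup>2)"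
        unfolding U_def V_def by (intro lipschitz_diff_squared_le Lip)
      also have "\<dots> = (\<Sum>p\<in>J. real (card J) * (Y n (\<omega> p) - Z (\<omega> p))\<^sup>2)"
        unfolding sum_distrib_left by (intro sum.cong) (auto simp: power2_commute)
      finally show "ennreal ((U \<omega> - V n \<omega>)\<^sup>2) \<le> (\<Sum>p\<in>J. ennreal (real (card J) * (Y n (\<omega> p) - Z (\<omega> p))\<^sup>2))"
        by (subst sum_ennreal) (auto intro: ennreal_leI)
    qed
    also have "\<dots> = (\<Sum>p\<in>J. \<integral>\<^sup>+\<omega>. ennreal (real (card J) * (Y n (\<omega> p) - Z (\<omega> p))\<^sup>2) \<partial>Q)"
      using cm[OF _ Ym] cm[OF _ Zm] by (intro nn_integral_sum) auto
    also have "\<dots> = (\<Sum>p\<in>J. ennreal (real (card J)) * e n)"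
    proof (intro sum.cong refl)
      fix p assume p: "p \<in> J"
      have "(\<integral>\<^sup>+\<omega>. ennreal (real (card J) * (Y n (\<omega> p) - Z (\<omega> p))\<^sup>2) \<partial>Q)
          = (\<integral>\<^sup>+x. ennreal (real (card J) * (Y n x - Z x)\<^sup>2) \<partial>\<Omega>)"
        by (rule coord[OF p, of "\<lambda>x. real (card J) * (Y n x - Z x)\<^sup>2"]) simp
      also have "\<dots> = ennreal (real (card J)) * e n"
        unfolding e_def by (subst nn_integral_cmult[symmetric]) (auto simp: ennreal_mult)
      finally show "(\<integral>\<^sup>+\<omega>. ennreal (real (card J) * (Y n (\<omega> p) - Z (\<omega> p))\<^sup>2) \<partial>Q) = ennreal (real (card J)) * e n" .
    qed
    also have "\<dots> = ennreal ((real (card J))\<^sup>2) * e n"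
      by (simp add: power2_eq_square ennreal_mult ennreal_of_nat_eq_real_of_nat mult.assoc)
    finally show ?thesis .
  qed
  have "(\<lambda>n. ennreal ((real (card J))\<^sup>2) * e n) \<longlonglongrightarrow> ennreal ((real (card J))\<^sup>2) * 0"
    by (intro ennreal_tendsto_cmult e) auto
  then have bound0: "(\<lambda>n. ennreal ((real (card J))\<^sup>2) * e n) \<longlonglongrightarrow> 0" by simp
  have "(\<lambda>n. ennreal (D n)) \<longlonglongrightarrow> ennreal 0"
    by (rule tendsto_sandwich[where f="\<lambda>_. 0" and h="\<lambda>n. ennreal ((real (card J))\<^sup>2) * e n"])
      (use De bound0 in auto)
  then have "D \<longlonglongrightarrow> 0" by (rule tendsto_ennrealD) (use D0 in auto)
  then have limD: "(\<lambda>n. 2 * B + 2 * D n) \<longlonglongrightarrow> 2 * B + 2 * 0" by (intro tendsto_intros)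
  have restr: "F (restrict x J) = F x" for x
    using Lip[of "restrict x J" x] Lip[of x "restrict x J"] by simp
  have varV: "Q.variance (V n) = cube_avg (J \<times> {..<Suc n}) (\<lambda>S. (F (rad_sum (Suc n) S))\<^sup>2)
      - (cube_avg (J \<times> {..<Suc n}) (\<lambda>S. F (rad_sum (Suc n) S)))\<^sup>2" for n
  proof -
    have tr: "Q.expectation (\<lambda>\<omega>. g (V n \<omega>)) = cube_avg (J \<times> {..<Suc n}) (\<lambda>S. g (F (rad_sum (Suc n) S)))"
      if [measurable]: "g \<in> borel_measurable borel" for g :: "real \<Rightarrow> real"
    proof -
      have gF: "(\<lambda>x. g (F x)) \<in> borel_measurable (PiM J (\<lambda>_. borel))" by measurable
      have "Q.expectation (\<lambda>\<omega>. g (V n \<omega>)) = (\<integral>x. g (F x) \<partial>PiM J (\<lambda>_. distr \<Omega> borel (Y n)))"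
        unfolding V_def Q_def by (rule integral_PiM_distr[OF J(1) Om Ym gF, symmetric])
      also have "\<dots> = cube_avg (J \<times> {..<Suc n}) (\<lambda>S. g (F (rad_sum (Suc n) S)))"
        unfolding Y by (rule integral_coin_sum_laws[OF J gF]) (simp only: restr)
      finally show ?thesis .
    qed
    have V1: "integrable Q (V n)" by (rule Q.square_integrable_imp_integrable[OF Vm V])
    show ?thesis
      unfolding Q.variance_eq[OF V1 V] using tr[of "\<lambda>x. x"] tr[of "\<lambda>x. x\<^sup>2"] by (simp del: lessThan_Suc)
  qed
  have varU: "Q.variance U = prob_space.variance G F"
  proof -
    have tr: "(\<integral>x. g (F x) \<partial>G) = Q.expectation (\<lambda>\<omega>. g (U \<omega>))"
      if [measurable]: "g \<in> borel_measurable borel" for g :: "real \<Rightarrow> real"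
    proof -
      have gF: "(\<lambda>x. g (F x)) \<in> borel_measurable (PiM J (\<lambda>_. borel))" by measurable
      show ?thesis
        using integral_PiM_distr[OF J(1) Om Zm gF] unfolding Z G_def U_def Q_def .
    qed
    show ?thesis using tr[of "\<lambda>x. x"] tr[of "\<lambda>x. (x - Q.expectation U)\<^sup>2"] by simp
  qed
  have "\<forall>\<^sub>F n in sequentially. Q.variance (V n) \<le> B"
    using cube[THEN eventually_compose_filterlim, OF filterlim_Suc] by (simp only: varV)
  then have "\<forall>\<^sub>F n in sequentially. Q.variance U \<le> 2 * B + 2 * D n"
  proof eventually_elim
    case (elim n)
    then show ?case using Q.variance_le_perturbed(1)[OF Um Vm U V, of n] by (simp add: D_def)
  qed
  then have "Q.variance U \<le> 2 * B + 2 * 0"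
    by (intro tendsto_lowerbound[OF limD]) auto
  then show ?thesis by (simp add: varU)
qed

section \<open>The variance of the discrepancy of a Gaussian matrix\<close>

lemma disc_eq_Min:
  "disc q (gaussian_mat N \<omega>)
    = Min ((\<lambda>\<sigma>. lq_norm q (Matrix.vec N (mat_act N \<omega> \<sigma>))) ` sign_vecs N)"
proof -
  have "gaussian_mat N \<omega> *\<^sub>v \<sigma> = Matrix.vec N (mat_act N \<omega> \<sigma>)" if "\<sigma> \<in> sign_vecs N" for \<sigma>
    using that by (auto simp: gaussian_mat_def mat_act_def sign_vecs_def scalar_prod_def lessThan_atLeast0)
  moreover have "dim_col (gaussian_mat N \<omega>) = N" by (simp add: gaussian_mat_def)
  ultimately show ?thesis by (simp add: disc_def)
qed

lemma lq_norm_vec_ereal: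
  "lq_norm (ereal r) (Matrix.vec N v) = (\<Sum>i<N. \<bar>v i\<bar> powr r) powr (1 / r)"
  by (simp add: lq_norm_def)

lemma lq_norm_vec_infinity:
  "0 < N \<Longrightarrow> lq_norm \<infinity> (Matrix.vec N v) = Max ((\<lambda>i. \<bar>v i\<bar>) ` {..<N})"
proof -
  assume N: "0 < N"
  have eq: "{\<bar>Matrix.vec N v $ i\<bar> | i. i < dim_vec (Matrix.vec N v)} = (\<lambda>i. \<bar>v i\<bar>) ` {..<N}" by force
  have "\<bar>v 0\<bar> \<le> Max ((\<lambda>i. \<bar>v i\<bar>) ` {..<N})" using N by (intro Max_ge) auto
  then have "0 \<le> Max ((\<lambda>i. \<bar>v i\<bar>) ` {..<N})" by linarith
  moreover have "Max (insert 0 ((\<lambda>i. \<bar>v i\<bar>) ` {..<N})) = max 0 (Max ((\<lambda>i. \<bar>v i\<bar>) ` {..<N}))"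
    using N by (intro Max_insert) auto
  ultimately show ?thesis unfolding lq_norm_def eq by simp
qed

lemma lq_norm_nonneg: "0 \<le> lq_norm q (Matrix.vec N v)"
  by (auto simp: lq_norm_def intro!: Max_ge)

lemma disc_nonneg: "0 \<le> disc q (gaussian_mat N \<omega>)"
proof -
  have "disc q (gaussian_mat N \<omega>) \<in> (\<lambda>\<sigma>. lq_norm q (Matrix.vec N (mat_act N \<omega> \<sigma>))) ` sign_vecs N"
    unfolding disc_eq_Min using finite_sign_vecs sign_vecs_nonempty by (intro Min_in) auto
  then show ?thesis using lq_norm_nonneg by auto
qed

text \<open>The second bound is the triangle inequality for the additional coordinate.\<close>

lemma lq_norm_reg_norm:
  assumes "1 \<le> r"
  shows "lq_norm (ereal r) (Matrix.vec N v) \<le> reg_norm r N v"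
    and "reg_norm r N v \<le> lq_norm (ereal r) (Matrix.vec N v) + 1"
proof -
  define s where "s = (\<Sum>i<N. \<bar>v i\<bar> powr r)"
  have s: "0 \<le> s" unfolding s_def by (intro sum_nonneg) auto
  show "lq_norm (ereal r) (Matrix.vec N v) \<le> reg_norm r N v"
    unfolding lq_norm_vec_ereal reg_norm_def s_def[symmetric] using s assms by (intro powr_mono2) auto
  define g where "g = s powr (1 / r)"
  have "g powr r = s" using s assms by (simp add: g_def powr_powr)
  moreover have "(0 + 1) powr r - 0 powr r \<le> (g + 1) powr r - g powr r"
    using assms by (intro powr_increment_mono) (auto simp: g_def)
  ultimately have "s + 1 \<le> (g + 1) powr r" by simp
  then have "reg_norm r N v powr r \<le> (g + 1) powr r"
    using reg_norm_powr[of r N v] assms by (simp add: s_def)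
  then have "reg_norm r N v \<le> g + 1"
    using assms by - (rule powr_le_cancel_exponent[of r], auto simp: g_def)
  then show "reg_norm r N v \<le> lq_norm (ereal r) (Matrix.vec N v) + 1"
    by (simp add: lq_norm_vec_ereal g_def s_def)
qed

lemma lq_norm_infinity_reg_norm:
  assumes "1 \<le> r" "0 < N"
  shows "lq_norm \<infinity> (Matrix.vec N v) \<le> reg_norm r N v"
    and "reg_norm r N v \<le> real N powr (1 / r) * lq_norm \<infinity> (Matrix.vec N v) + 1"
proof -
  define x where "x = lq_norm \<infinity> (Matrix.vec N v)"
  have xM: "x = Max ((\<lambda>i. \<bar>v i\<bar>) ` {..<N})" using assms by (simp add: x_def lq_norm_vec_infinity)
  have "x \<in> (\<lambda>i. \<bar>v i\<bar>) ` {..<N}" unfolding xM using assms by (intro Max_in) auto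
  then show "lq_norm \<infinity> (Matrix.vec N v) \<le> reg_norm r N v"
    using assms by (auto simp: x_def[symmetric] intro: abs_le_reg_norm)
  have le: "\<bar>v i\<bar> \<le> x" if "i < N" for i unfolding xM using that by (intro Max_ge) auto
  have x0: "0 \<le> x" using lq_norm_nonneg by (simp add: x_def)
  have "(\<Sum>i<N. \<bar>v i\<bar> powr r) \<le> (\<Sum>i<N. x powr r)"
    using le assms by (intro sum_mono powr_mono2) auto
  then have "(\<Sum>i<N. \<bar>v i\<bar> powr r) powr (1 / r) \<le> (real N * x powr r) powr (1 / r)"
    using assms by (intro powr_mono2) (auto intro: sum_nonneg)
  also have "\<dots> = real N powr (1 / r) * x"
    using x0 assms by (simp add: powr_mult powr_powr)
  finally show "reg_norm r N v \<le> real N powr (1 / r) * lq_norm \<infinity> (Matrix.vec N v) + 1"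
    using lq_norm_reg_norm(2)[OF assms(1), of N v] by (simp add: lq_norm_vec_ereal x_def)
qed

lemma disc_reg_disc:
  assumes "1 \<le> r"
  shows "\<bar>disc (ereal r) (gaussian_mat N \<omega>) - reg_disc r N \<omega>\<bar> \<le> 1"
proof -
  have "disc (ereal r) (gaussian_mat N \<omega>) \<le> 1 * reg_disc r N \<omega> + 0"
    unfolding disc_eq_Min reg_disc_def by (intro Min_sign_vecs_le) (use lq_norm_reg_norm(1)[OF assms] in simp)
  moreover have "reg_disc r N \<omega> \<le> 1 * disc (ereal r) (gaussian_mat N \<omega>) + 1"
    unfolding disc_eq_Min reg_disc_def by (intro Min_sign_vecs_le) (use lq_norm_reg_norm(2)[OF assms] in simp)
  ultimately show ?thesis by simp
qed

lemma disc_infinity_reg_disc: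
  assumes "1 \<le> r" "0 < N"
  shows "disc \<infinity> (gaussian_mat N \<omega>) \<le> reg_disc r N \<omega>"
    and "reg_disc r N \<omega> \<le> real N powr (1 / r) * disc \<infinity> (gaussian_mat N \<omega>) + 1"
proof -
  have "disc \<infinity> (gaussian_mat N \<omega>) \<le> 1 * reg_disc r N \<omega> + 0"
    unfolding disc_eq_Min reg_disc_def by (intro Min_sign_vecs_le) (use lq_norm_infinity_reg_norm(1)[OF assms] in simp)
  then show "disc \<infinity> (gaussian_mat N \<omega>) \<le> reg_disc r N \<omega>" by simp
  show "reg_disc r N \<omega> \<le> real N powr (1 / r) * disc \<infinity> (gaussian_mat N \<omega>) + 1"
    unfolding disc_eq_Min reg_disc_def by (intro Min_sign_vecs_le lq_norm_infinity_reg_norm(2)[OF assms])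
qed

abbreviation "entry_borel N \<equiv> PiM ({..<N} \<times> {..<N}) (\<lambda>_. borel :: real measure)"

lemma measurable_mat_act [measurable]:
  assumes "i < N"
  shows "(\<lambda>\<omega>. mat_act N \<omega> \<sigma> i) \<in> borel_measurable (entry_borel N)"
  unfolding mat_act_def
  by (intro borel_measurable_sum borel_measurable_times measurable_component_singleton) (use assms in auto)

lemma measurable_reg_disc [measurable]: "reg_disc r N \<in> borel_measurable (entry_borel N)"
proof -
  have "(\<lambda>\<omega>. reg_norm r N (mat_act N \<omega> \<sigma>)) \<in> borel_measurable (entry_borel N)" for \<sigma>
    unfolding reg_norm_def
    by (intro powr_real_measurable borel_measurable_add borel_measurable_sum borel_measurable_abs measurable_mat_act
        borel_measurable_const) auto
  then show ?thesis
    unfolding reg_disc_def[abs_def] by (intro borel_measurable_Min finite_sign_vecs)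
qed

lemma measurable_disc:
  assumes "0 < N" "0 \<le> q"
  shows "(\<lambda>\<omega>. disc q (gaussian_mat N \<omega>)) \<in> borel_measurable (entry_borel N)"
proof -
  have "(\<lambda>\<omega>. lq_norm q (Matrix.vec N (mat_act N \<omega> \<sigma>))) \<in> borel_measurable (entry_borel N)" for \<sigma>
  proof (cases q)
    case (real r)
    show ?thesis unfolding real lq_norm_vec_ereal
      by (intro powr_real_measurable borel_measurable_sum borel_measurable_abs measurable_mat_act
          borel_measurable_const) auto
  next
    case PInf
    then show ?thesis unfolding PInf lq_norm_vec_infinity[OF assms(1)]
      by (intro borel_measurable_Max borel_measurable_abs measurable_mat_act) auto
  qed (use assms in auto)
  then show ?thesis
    unfolding disc_eq_Min by (intro borel_measurable_Min finite_sign_vecs)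
qed

lemma sets_gaussian_entries [measurable_cong]: "sets (gaussian_entries N) = sets (entry_borel N)"
  unfolding gaussian_entries_def by (intro sets_PiM_cong) auto

lemma measurable_gaussian_entries:
  "f \<in> borel_measurable (entry_borel N) \<Longrightarrow> f \<in> borel_measurable (gaussian_entries N)"
  using measurable_cong_sets[OF sets_gaussian_entries refl] by blast

lemma square_integrable_reg_disc:
  assumes "1 \<le> r" "0 < N"
  shows "integrable (gaussian_entries N) (\<lambda>\<omega>. (reg_disc r N \<omega>)\<^sup>2)"
proof -
  let ?J = "{..<N} \<times> {..<N}"
  let ?G = "gaussian_entries N"
  interpret G: prob_space ?G by (rule prob_space_gaussian_entries)
  have comp: "(\<lambda>\<omega>. \<omega> p) \<in> measurable ?G std_normal_distribution" if "p \<in> ?J" for p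
    unfolding gaussian_entries_def using that by (rule measurable_component_singleton)
  have marg: "distr ?G std_normal_distribution (\<lambda>\<omega>. \<omega> p) = std_normal_distribution" if "p \<in> ?J" for p
    unfolding gaussian_entries_def using that prob_space_normal_density[of 1 0]
    by (intro distr_PiM_component) auto
  have sq: "integrable ?G (\<lambda>\<omega>. (\<omega> p)\<^sup>2)" if "p \<in> ?J" for p
    using integrable_std_normal_distribution_moment[of 2]
    by (subst (asm) marg[OF that, symmetric], subst (asm) integrable_distr_eq) (use comp[OF that] in auto)
  have "integrable ?G (\<lambda>\<omega>. (reg_disc r N (\<lambda>p\<in>?J. \<omega> p))\<^sup>2)"
    by (rule G.lipschitz_square_integrable(1)[of ?J "reg_disc r N" "\<lambda>p \<omega>. \<omega> p"])
      (use sq comp reg_disc_le_add[OF assms(1)] in auto)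
  moreover have "reg_disc r N (\<lambda>p\<in>?J. \<omega> p) = reg_disc r N \<omega>" for \<omega>
    by (simp add: reg_disc_def reg_norm_def mat_act_def)
  ultimately show ?thesis by simp
qed

lemma variance_reg_disc_le:
  assumes "2 \<le> r" "0 < N"
  shows "(1 + (1 - 2 / r) * ln (real N)) * prob_space.variance (gaussian_entries N) (reg_disc r N) \<le> 352 * real N"
proof -
  define l where "l = 1 + (1 - 2 / r) * ln (real N)"
  have "0 \<le> (1 - 2 / r) * ln (real N)" using assms by (intro mult_nonneg_nonneg) auto
  then have l: "l > 0" by (simp add: l_def)
  have "prob_space.variance (gaussian_entries N) (reg_disc r N) \<le> 2 * (176 * real N / l)"
    unfolding gaussian_entries_def
  proof (rule gaussian_variance_le_cube)
    show "\<forall>\<^sub>F m in sequentially. cube_avg (({..<N} \<times> {..<N}) \<times> {..<m}) (\<lambda>S. (reg_disc r N (rad_sum m S))\<^sup>2)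
      - (cube_avg (({..<N} \<times> {..<N}) \<times> {..<m}) (\<lambda>S. reg_disc r N (rad_sum m S)))\<^sup>2 \<le> 176 * real N / l"
      using cube_variance_reg_disc[OF assms]
      unfolding l_def[symmetric] by eventually_elim (use l in \<open>simp add: pos_le_divide_eq mult.commute\<close>)
  qed (use assms in \<open>auto intro: reg_disc_le_add\<close>)
  then show ?thesis unfolding l_def[symmetric] using l by (simp add: pos_le_divide_eq mult.commute)
qed

lemma square_integrable_disc:
  assumes "0 < N" "2 \<le> q"
  shows "integrable (gaussian_entries N) (\<lambda>\<omega>. (disc q (gaussian_mat N \<omega>))\<^sup>2)"
proof -
  have q: "0 \<le> q" using assms(2) by (rule order_trans[rotated]) simp
  obtain r where r: "1 \<le> r" and le: "\<And>\<omega>. disc q (gaussian_mat N \<omega>) \<le> reg_disc r N \<omega> + 1"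
  proof (cases q)
    case (real r)
    then have "1 \<le> r" using assms(2) by simp
    then show thesis using that[of r] disc_reg_disc[of r N] real by (smt (verit))
  next
    case PInf
    then show thesis using that[of 1] disc_infinity_reg_disc(1)[of 1 N] assms(1) by (smt (verit))
  qed (use assms in auto)
  show ?thesis
  proof (rule Bochner_Integration.integrable_bound)
    show "integrable (gaussian_entries N) (\<lambda>\<omega>. 2 * (reg_disc r N \<omega>)\<^sup>2 + 2)"
      using square_integrable_reg_disc[OF r assms(1)] prob_space.prob_space[OF prob_space_gaussian_entries]
        prob_space.finite_measure[OF prob_space_gaussian_entries, of N]
      by (auto intro!: finite_measure.integrable_const)
    show "(\<lambda>\<omega>. (disc q (gaussian_mat N \<omega>))\<^sup>2) \<in> borel_measurable (gaussian_entries N)"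
      using measurable_gaussian_entries[OF measurable_disc[OF assms(1) q]] by measurable
    show "AE \<omega> in gaussian_entries N. norm ((disc q (gaussian_mat N \<omega>))\<^sup>2) \<le> norm (2 * (reg_disc r N \<omega>)\<^sup>2 + 2)"
    proof (rule AE_I2)
      fix \<omega>
      have "(disc q (gaussian_mat N \<omega>))\<^sup>2 \<le> (reg_disc r N \<omega> + 1)\<^sup>2"
        using le disc_nonneg by (intro power_mono) auto
      also have "\<dots> \<le> 2 * (reg_disc r N \<omega>)\<^sup>2 + 2"
        using zero_le_power2[of "reg_disc r N \<omega> - 1"] by (simp add: power2_eq_square algebra_simps)
      finally show "norm ((disc q (gaussian_mat N \<omega>))\<^sup>2) \<le> norm (2 * (reg_disc r N \<omega>)\<^sup>2 + 2)" by simp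
    qed
  qed
qed

lemma real_of_ereal_one_divide: "0 < r \<Longrightarrow> real_of_ereal (1 / ereal r) = 1 / r"
  by (simp add: one_ereal_def)

text \<open>For finite \<open>q\<close> the exponent \<open>r = q\<close> works. For \<open>q = \<infinity>\<close> the ratio of the \<open>\<ell>\<^sup>r\<close> norm to the sup norm is
  at most \<open>N powr (1 / r)\<close>, which is arbitrarily close to 1 for large \<open>r\<close>; how large depends on \<open>N\<close>
  through a second moment, and \<open>r \<ge> 4\<close> ensures \<open>1 / 2 \<le> 1 - 2 / r\<close>.\<close>

lemma disc_approx_by_reg_disc:
  assumes N: "0 < N" and q: "2 \<le> q"
  obtains r where "2 \<le> r" "1 / 2 - real_of_ereal (1 / q) \<le> 1 - 2 / r"
    "prob_space.expectation (gaussian_entries N) (\<lambda>\<omega>. (disc q (gaussian_mat N \<omega>) - reg_disc r N \<omega>)\<^sup>2) \<le> 4"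
proof -
  interpret G: prob_space "gaussian_entries N" by (rule prob_space_gaussian_entries)
  have q0: "0 \<le> q" using q by (rule order_trans[rotated]) simp
  have int: "integrable (gaussian_entries N) (\<lambda>\<omega>. (disc q (gaussian_mat N \<omega>) - reg_disc r N \<omega>)\<^sup>2)" if "1 \<le> r" for r
    by (intro G.variance_le_perturbed(2) measurable_gaussian_entries measurable_disc[OF N q0] measurable_reg_disc
        square_integrable_disc[OF N q] square_integrable_reg_disc[OF that N])
  show thesis
  proof (cases q)
    case (real r)
    have r: "2 \<le> r" using q real by simp
    have "G.expectation (\<lambda>\<omega>. (disc q (gaussian_mat N \<omega>) - reg_disc r N \<omega>)\<^sup>2) \<le> G.expectation (\<lambda>\<omega>. 4)"
    proof (intro integral_mono int)
      fix \<omega>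
      have "\<bar>disc q (gaussian_mat N \<omega>) - reg_disc r N \<omega>\<bar>\<^sup>2 \<le> 1\<^sup>2"
        using disc_reg_disc[of r N \<omega>] r real by (intro power_mono) auto
      then show "(disc q (gaussian_mat N \<omega>) - reg_disc r N \<omega>)\<^sup>2 \<le> 4" by simp
    qed (use r in auto)
    also have "\<dots> = 4" by (simp add: G.prob_space)
    finally show thesis using r real by (intro that[of r]) (auto simp: real_of_ereal_one_divide field_simps)
  next
    case PInf
    define E where "E = G.expectation (\<lambda>\<omega>. (reg_disc 2 N \<omega>)\<^sup>2)"
    have E0: "0 \<le> E" by (simp add: E_def)
    have "((\<lambda>r::real. 1 / r) \<longlongrightarrow> 0) at_top" by real_asymp
    then have "((\<lambda>r. 2 * (real N powr (1 / r) - 1)\<^sup>2 * E) \<longlongrightarrow> 2 * (real N powr 0 - 1)\<^sup>2 * E) at_top"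
      using N by (intro tendsto_intros) auto
    then have "((\<lambda>r. 2 * (real N powr (1 / r) - 1)\<^sup>2 * E) \<longlongrightarrow> 0) at_top" using N by simp
    then have "\<forall>\<^sub>F r in at_top. 2 * (real N powr (1 / r) - 1)\<^sup>2 * E < 2"
      by (rule order_tendstoD) simp
    then obtain r where r: "4 \<le> r" and small: "2 * (real N powr (1 / r) - 1)\<^sup>2 * E < 2"
      using eventually_happens[OF eventually_conj[OF _ eventually_ge_at_top[of 4]]] by force
    define a where "a = real N powr (1 / r) - 1"
    have a0: "0 \<le> a" using N r by (simp add: a_def ge_one_powr_ge_zero)
    have "G.expectation (\<lambda>\<omega>. (disc q (gaussian_mat N \<omega>) - reg_disc r N \<omega>)\<^sup>2)
        \<le> G.expectation (\<lambda>\<omega>. 2 * a\<^sup>2 * (reg_disc 2 N \<omega>)\<^sup>2 + 2)"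
    proof (intro integral_mono int)
      show "integrable (gaussian_entries N) (\<lambda>\<omega>. 2 * a\<^sup>2 * (reg_disc 2 N \<omega>)\<^sup>2 + 2)"
        using square_integrable_reg_disc[of 2 N] N by auto
      fix \<omega>
      define d where "d = disc q (gaussian_mat N \<omega>)"
      have d: "0 \<le> d" "d \<le> reg_disc 2 N \<omega>" "d \<le> reg_disc r N \<omega>" "reg_disc r N \<omega> \<le> (a + 1) * d + 1"
        using disc_nonneg disc_infinity_reg_disc[of 2 N \<omega>] disc_infinity_reg_disc[of r N \<omega>] N r
        by (auto simp: d_def PInf a_def)
      have "a * d \<le> a * reg_disc 2 N \<omega>" using d a0 by (intro mult_left_mono) auto
      then have "\<bar>d - reg_disc r N \<omega>\<bar> \<le> a * reg_disc 2 N \<omega> + 1" using d by (simp add: algebra_simps)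
      then have "\<bar>d - reg_disc r N \<omega>\<bar>\<^sup>2 \<le> (a * reg_disc 2 N \<omega> + 1)\<^sup>2" by (intro power_mono) auto
      also have "\<dots> \<le> 2 * a\<^sup>2 * (reg_disc 2 N \<omega>)\<^sup>2 + 2"
        using zero_le_power2[of "a * reg_disc 2 N \<omega> - 1"] by (simp add: power2_eq_square algebra_simps)
      finally show "(disc q (gaussian_mat N \<omega>) - reg_disc r N \<omega>)\<^sup>2 \<le> 2 * a\<^sup>2 * (reg_disc 2 N \<omega>)\<^sup>2 + 2"
        by (simp add: d_def)
    qed (use r in auto)
    also have "\<dots> = 2 * a\<^sup>2 * E + 2"
      using square_integrable_reg_disc[of 2 N] N by (simp add: E_def G.prob_space)
    also have "\<dots> \<le> 4" using small by (simp add: a_def)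
    finally show thesis using r PInf by (intro that[of r]) (auto simp: field_simps)
  qed (use q in auto)
qed

text \<open>The constant mean square error of the regularisation is harmless because the logarithmic factor is
  at most \<open>N\<close>.\<close>

theorem variance_disc_le:
  assumes N: "0 < N" and q: "2 \<le> q"
  shows "(1 + (1 / 2 - real_of_ereal (1 / q)) * ln (real N))
      * prob_space.variance (gaussian_entries N) (\<lambda>\<omega>. disc q (gaussian_mat N \<omega>))
    \<le> 712 * real N"
proof -
  interpret G: prob_space "gaussian_entries N" by (rule prob_space_gaussian_entries)
  have q0: "0 \<le> q" using q by (rule order_trans[rotated]) simp
  obtain r where r: "2 \<le> r" "1 / 2 - real_of_ereal (1 / q) \<le> 1 - 2 / r"
    and approx: "G.expectation (\<lambda>\<omega>. (disc q (gaussian_mat N \<omega>) - reg_disc r N \<omega>)\<^sup>2) \<le> 4"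
    by (rule disc_approx_by_reg_disc[OF N q])
  define l where "l = 1 + (1 - 2 / r) * ln (real N)"
  have lnN: "0 \<le> ln (real N)" using N by simp
  have "(1 - 2 / r) * ln (real N) \<le> 1 * ln (real N)" using r lnN by (intro mult_right_mono) auto
  also have "\<dots> \<le> real N - 1" using N ln_le_minus_one[of "real N"] by simp
  finally have lN: "l \<le> real N" by (simp add: l_def)
  have "0 \<le> (1 - 2 / r) * ln (real N)" using r lnN by (intro mult_nonneg_nonneg) auto
  then have l0: "0 \<le> l" by (simp add: l_def)
  have "(1 + (1 / 2 - real_of_ereal (1 / q)) * ln (real N)) * G.variance (\<lambda>\<omega>. disc q (gaussian_mat N \<omega>))
      \<le> l * G.variance (\<lambda>\<omega>. disc q (gaussian_mat N \<omega>))"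
    unfolding l_def using r lnN by (intro mult_right_mono add_left_mono G.variance_positive) auto
  also have "\<dots> \<le> l * (2 * G.variance (reg_disc r N) + 2 * 4)"
  proof (intro mult_left_mono l0)
    have "G.variance (\<lambda>\<omega>. disc q (gaussian_mat N \<omega>)) \<le> 2 * G.variance (reg_disc r N)
        + 2 * G.expectation (\<lambda>\<omega>. (disc q (gaussian_mat N \<omega>) - reg_disc r N \<omega>)\<^sup>2)"
      using r by (intro G.variance_le_perturbed(1) measurable_gaussian_entries measurable_disc[OF N q0] measurable_reg_disc
        square_integrable_disc[OF N q] square_integrable_reg_disc[OF _ N]) simp
    then show "G.variance (\<lambda>\<omega>. disc q (gaussian_mat N \<omega>)) \<le> 2 * G.variance (reg_disc r N) + 2 * 4"
      using approx by linarith
  qed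
  also have "\<dots> = 2 * (l * G.variance (reg_disc r N)) + 8 * l" by (simp add: algebra_simps)
  also have "\<dots> \<le> 2 * (352 * real N) + 8 * real N"
    using variance_reg_disc_le[OF r(1) N] lN by (intro add_mono mult_left_mono) (auto simp: l_def)
  finally show ?thesis by simp
qed

section \<open>The expected discrepancy of a Gaussian matrix\<close>

lemma indep_gaussian_entries:
  assumes "0 < N"
  shows "prob_space.indep_vars (gaussian_entries N) (\<lambda>_. borel) (\<lambda>p \<omega>. \<omega> p) ({..<N} \<times> {..<N})"
    and "p \<in> {..<N} \<times> {..<N} \<Longrightarrow> distributed (gaussian_entries N) lborel (\<lambda>\<omega>. \<omega> p) std_normal_density"
proof -
  let ?G = "gaussian_entries N"
  let ?J = "{..<N} \<times> {..<N}"
  interpret G: prob_space ?G by (rule prob_space_gaussian_entries)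
  have rv: "(\<lambda>\<omega>. \<omega> p) \<in> borel_measurable ?G" if "p \<in> ?J" for p
    by (intro measurable_gaussian_entries measurable_component_singleton that)
  have marg: "distr ?G borel (\<lambda>\<omega>. \<omega> p) = std_normal_distribution" if "p \<in> ?J" for p
  proof -
    have "distr ?G std_normal_distribution (\<lambda>\<omega>. \<omega> p) = std_normal_distribution"
      unfolding gaussian_entries_def using that prob_space_normal_density[of 1 0]
      by (intro distr_PiM_component) auto
    moreover have "distr ?G std_normal_distribution (\<lambda>\<omega>. \<omega> p) = distr ?G borel (\<lambda>\<omega>. \<omega> p)"
      by (intro distr_cong) auto
    ultimately show ?thesis by simp
  qed
  have "distr ?G (entry_borel N) (\<lambda>\<omega>. \<lambda>p\<in>?J. \<omega> p) = distr ?G ?G (\<lambda>\<omega>. \<omega>)"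
  proof (rule distr_cong)
    show "sets (entry_borel N) = sets ?G" by (simp add: sets_gaussian_entries)
    show "(\<lambda>p\<in>?J. \<omega> p) = \<omega>" if "\<omega> \<in> space ?G" for \<omega>
      using that by (auto simp: gaussian_entries_def space_PiM PiE_def extensional_restrict)
  qed simp
  also have "\<dots> = ?G" by (rule distr_id)
  also have "\<dots> = PiM ?J (\<lambda>p. distr ?G borel (\<lambda>\<omega>. \<omega> p))"
    unfolding gaussian_entries_def[of N] by (intro PiM_cong) (simp_all add: marg[unfolded gaussian_entries_def])
  finally show "G.indep_vars (\<lambda>_. borel) (\<lambda>p \<omega>. \<omega> p) ?J"
    using assms rv by (subst G.indep_vars_iff_distr_eq_PiM') auto
  show "distributed ?G lborel (\<lambda>\<omega>. \<omega> p) std_normal_density" if p: "p \<in> ?J"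
  proof -
    have "distr ?G lborel (\<lambda>\<omega>. \<omega> p) = distr ?G borel (\<lambda>\<omega>. \<omega> p)" by (intro distr_cong) auto
    then show ?thesis using marg[OF p] rv[OF p] by (simp add: distributed_def)
  qed
qed

text \<open>Flipping signs does not change the law of a centred normal variable.\<close>

lemma distributed_mat_act:
  assumes s: "\<sigma> \<in> sign_vecs N" and i: "i < N"
  shows "distributed (gaussian_entries N) lborel (\<lambda>\<omega>. mat_act N \<omega> \<sigma> i) (normal_density 0 (sqrt (real N)))"
proof -
  let ?G = "gaussian_entries N"
  let ?R = "{i} \<times> {..<N}"
  interpret G: prob_space ?G by (rule prob_space_gaussian_entries)
  have N: "0 < N" using i by simp
  have "distributed ?G lborel (\<lambda>\<omega>. \<Sum>p\<in>?R. \<omega> p * \<sigma> $ snd p)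
      (normal_density (\<Sum>p\<in>?R. 0) (sqrt (\<Sum>p\<in>?R. 1\<^sup>2)))"
  proof (rule G.sum_indep_normal)
    have "G.indep_vars (\<lambda>_. borel) (\<lambda>p \<omega>. \<omega> p) ?R"
      by (rule G.indep_vars_subset[OF indep_gaussian_entries(1)[OF N]]) (use i in auto)
    then show "G.indep_vars (\<lambda>_. borel) (\<lambda>p \<omega>. \<omega> p * \<sigma> $ snd p) ?R"
      by (rule G.indep_vars_compose2) auto
    fix p assume p: "p \<in> ?R"
    then have sp: "\<bar>\<sigma> $ snd p\<bar> = 1" using sign_vecs_abs[OF s] by auto
    have "distributed ?G lborel (\<lambda>\<omega>. \<omega> p) (normal_density 0 1)"
      by (rule indep_gaussian_entries(2)[OF N]) (use p i in auto)
    then have "distributed ?G lborel (\<lambda>\<omega>. 0 + \<sigma> $ snd p * \<omega> p) (normal_density (0 + \<sigma> $ snd p * 0) (\<bar>\<sigma> $ snd p\<bar> * 1))"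
      by (rule G.normal_density_affine) (use sp in auto)
    then show "distributed ?G lborel (\<lambda>\<omega>. \<omega> p * \<sigma> $ snd p) (normal_density 0 1)"
      using sp by (simp add: mult.commute)
  qed (use N in auto)
  then show ?thesis
    by (simp add: sum.cartesian_product' mat_act_def card_cartesian_product)
qed

lemma indep_mat_act:
  assumes "0 < N"
  shows "prob_space.indep_vars (gaussian_entries N) (\<lambda>_. borel) (\<lambda>i \<omega>. mat_act N \<omega> \<sigma> i) {..<N}"
proof -
  interpret G: prob_space "gaussian_entries N" by (rule prob_space_gaussian_entries)
  have "G.indep_vars (\<lambda>i. PiM ({i} \<times> {..<N}) (\<lambda>_. borel)) (\<lambda>i \<omega>. restrict (\<lambda>p. \<omega> p) ({i} \<times> {..<N})) {..<N}"
    by (rule G.indep_vars_restrict[OF indep_gaussian_entries(1)[OF assms]]) (auto simp: disjoint_family_on_def)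
  moreover have "(\<lambda>x. \<Sum>j<N. x (i, j) * \<sigma> $ j) \<in> borel_measurable (PiM ({i} \<times> {..<N}) (\<lambda>_. borel))" for i :: nat
    by (intro borel_measurable_sum borel_measurable_times measurable_component_singleton) auto
  ultimately have "G.indep_vars (\<lambda>_. borel)
      (\<lambda>i \<omega>. \<Sum>j<N. (restrict (\<lambda>p. \<omega> p) ({i} \<times> {..<N})) (i, j) * \<sigma> $ j) {..<N}"
    by (rule G.indep_vars_compose2)
  then show ?thesis by (simp add: mat_act_def)
qed

text \<open>Dropping the Gaussian factor bounds the density by the constant \<open>1 / sqrt (2 * pi * N)\<close>, and the
  remaining exponential is \<open>1 / 16\<close> of a normal density with standard deviation \<open>sqrt N / 16\<close>.\<close>

lemma laplace_normal_square:
  assumes "0 < N"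
  shows "(\<integral>\<^sup>+x. ennreal (normal_density 0 (sqrt (real N)) x) * ennreal (exp (- 128 * x\<^sup>2 / real N)) \<partial>lborel) \<le> ennreal (1 / 16)"
proof -
  have *: "normal_density 0 (sqrt (real N)) x * exp (- 128 * x\<^sup>2 / real N)
      \<le> 1 / 16 * normal_density 0 (sqrt (real N) / 16) x" for x
  proof -
    define A where "A = sqrt (2 * pi * real N)"
    have A: "A \<ge> 0" by (simp add: A_def)
    have "sqrt (2 * pi * (sqrt (real N) / 16)\<^sup>2) = A / 16"
      using real_sqrt_divide[of "2 * pi * real N" "16\<^sup>2"] by (simp add: power_divide A_def)
    moreover have "- (x - 0)\<^sup>2 / (2 * (sqrt (real N) / 16)\<^sup>2) = - 128 * x\<^sup>2 / real N"
      by (simp add: power_divide)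
    ultimately have narrow: "normal_density 0 (sqrt (real N) / 16) x = 16 * (exp (- 128 * x\<^sup>2 / real N) / A)"
      unfolding normal_density_def by (simp only:) simp
    have "normal_density 0 (sqrt (real N)) x \<le> 1 / A"
      using A unfolding normal_density_def A_def by (simp add: divide_right_mono)
    then have "normal_density 0 (sqrt (real N)) x * exp (- 128 * x\<^sup>2 / real N) \<le> 1 / A * exp (- 128 * x\<^sup>2 / real N)"
      by (intro mult_right_mono) auto
    then show ?thesis unfolding narrow by simp
  qed
  have "(\<integral>\<^sup>+x. ennreal (normal_density 0 (sqrt (real N)) x) * ennreal (exp (- 128 * x\<^sup>2 / real N)) \<partial>lborel)
      \<le> (\<integral>\<^sup>+x. ennreal (1 / 16) * ennreal (normal_density 0 (sqrt (real N) / 16) x) \<partial>lborel)"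
    using * by (intro nn_integral_mono) (simp add: ennreal_mult[symmetric] ennreal_leI del: ennreal_numeral)
  also have "\<dots> = ennreal (1 / 16) * (\<integral>\<^sup>+x. ennreal (normal_density 0 (sqrt (real N) / 16) x) \<partial>lborel)"
    by (intro nn_integral_cmult) simp
  also have "(\<integral>\<^sup>+x. ennreal (normal_density 0 (sqrt (real N) / 16) x) \<partial>lborel) = 1"
    using assms by (subst nn_integral_eq_integral) (auto simp: integral_normal_density)
  finally show ?thesis by simp
qed

lemma laplace_mat_act:
  assumes N: "0 < N" and s: "\<sigma> \<in> sign_vecs N"
  shows "(\<integral>\<^sup>+\<omega>. ennreal (exp (- 128 * (\<Sum>i<N. (mat_act N \<omega> \<sigma> i)\<^sup>2) / real N)) \<partial>gaussian_entries N) \<le> ennreal ((1 / 16) ^ N)"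
proof -
  let ?G = "gaussian_entries N"
  interpret G: prob_space ?G by (rule prob_space_gaussian_entries)
  let ?e = "\<lambda>x::real. ennreal (exp (- 128 * x\<^sup>2 / real N))"
  have "(\<integral>\<^sup>+\<omega>. ennreal (exp (- 128 * (\<Sum>i<N. (mat_act N \<omega> \<sigma> i)\<^sup>2) / real N)) \<partial>?G)
      = (\<integral>\<^sup>+\<omega>. (\<Prod>i<N. ?e (mat_act N \<omega> \<sigma> i)) \<partial>?G)"
    by (simp add: prod_ennreal exp_sum[symmetric] sum_distrib_left sum_divide_distrib)
  also have "\<dots> = (\<Prod>i<N. \<integral>\<^sup>+\<omega>. ?e (mat_act N \<omega> \<sigma> i) \<partial>?G)"
    by (intro G.indep_vars_nn_integral G.indep_vars_compose2[OF indep_mat_act[OF N]]) auto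
  also have "\<dots> \<le> (\<Prod>i<N. ennreal (1 / 16))"
  proof (intro prod_mono_ennreal)
    fix i assume "i \<in> {..<N}"
    then have "(\<integral>\<^sup>+\<omega>. ?e (mat_act N \<omega> \<sigma> i) \<partial>?G)
        = (\<integral>\<^sup>+x. ennreal (normal_density 0 (sqrt (real N)) x) * ?e x \<partial>lborel)"
      by (intro distributed_nn_integral[symmetric] distributed_mat_act[OF s]) auto
    then show "(\<integral>\<^sup>+\<omega>. ?e (mat_act N \<omega> \<sigma> i) \<partial>?G) \<le> ennreal (1 / 16)"
      using laplace_normal_square[OF N] by simp
  qed
  also have "\<dots> = ennreal ((1 / 16) ^ N)" by (simp add: ennreal_power)
  finally show ?thesis .
qed

lemma card_sign_vecs_le: "card (sign_vecs N) \<le> 2 ^ N"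
proof -
  have "inj_on (\<lambda>\<sigma>. \<lambda>j\<in>{..<N}. \<sigma> $ j) (sign_vecs N)"
  proof (rule inj_onI)
    fix \<sigma> \<tau> :: "real vec"
    assume st: "\<sigma> \<in> sign_vecs N" "\<tau> \<in> sign_vecs N"
      and eq: "(\<lambda>j\<in>{..<N}. \<sigma> $ j) = (\<lambda>j\<in>{..<N}. \<tau> $ j)"
    show "\<sigma> = \<tau>"
    proof (rule eq_vecI)
      have dim: "dim_vec \<sigma> = N" "dim_vec \<tau> = N" using st by (auto simp: sign_vecs_def)
      then show "dim_vec \<sigma> = dim_vec \<tau>" by simp
      fix j assume "j < dim_vec \<tau>"
      then show "\<sigma> $ j = \<tau> $ j" using fun_cong[OF eq, of j] dim by simp
    qed
  qed
  moreover have "(\<lambda>\<sigma>. \<lambda>j\<in>{..<N}. \<sigma> $ j) ` sign_vecs N \<subseteq> {..<N} \<rightarrow>\<^sub>E {- 1 :: real, 1}"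
    by (auto simp: sign_vecs_def split: if_splits)
  ultimately have "card (sign_vecs N) \<le> card ({..<N} \<rightarrow>\<^sub>E {- 1 :: real, 1})"
    by (rule card_inj_on_le) (auto intro!: finite_PiE)
  also have "\<dots> = 2 ^ N" by (simp add: card_PiE card_insert_if numeral_2_eq_2)
  finally show ?thesis .
qed

text \<open>Markov's inequality for the sum of the Laplace transforms over all signings. The constant 128 makes
  the Laplace transform per row, \<open>1 / 16\<close>, beat both the factor 2 per column from the number of
  signings and the factor \<open>exp 1\<close> from the threshold.\<close>

lemma prob_some_signing_small:
  assumes N: "0 < N"
  defines "bad \<equiv> \<lambda>\<omega>. \<exists>\<sigma>\<in>sign_vecs N. (\<Sum>i<N. (mat_act N \<omega> \<sigma> i)\<^sup>2) \<le> (real N)\<^sup>2 / 128"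
  shows "measure (gaussian_entries N) {\<omega> \<in> space (gaussian_entries N). bad \<omega>} \<le> 1 / 2"
    and "{\<omega> \<in> space (gaussian_entries N). bad \<omega>} \<in> sets (gaussian_entries N)"
proof -
  let ?G = "gaussian_entries N"
  interpret G: prob_space ?G by (rule prob_space_gaussian_entries)
  define s where "s = (\<lambda>\<omega> \<sigma>. \<Sum>i<N. (mat_act N \<omega> \<sigma> i)\<^sup>2)"
  have sm: "(\<lambda>\<omega>. s \<omega> \<sigma>) \<in> borel_measurable ?G" for \<sigma>
    unfolding s_def by (intro measurable_gaussian_entries borel_measurable_sum borel_measurable_power measurable_mat_act) auto
  let ?B = "{\<omega> \<in> space ?G. bad \<omega>}"
  let ?E = "\<lambda>\<omega> \<sigma>. ennreal (exp (- 128 * s \<omega> \<sigma> / real N))"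
  have "?B = (\<Union>\<sigma>\<in>sign_vecs N. {\<omega> \<in> space ?G. s \<omega> \<sigma> \<le> (real N)\<^sup>2 / 128})"
    by (auto simp: bad_def s_def)
  also have "\<dots> \<in> sets ?G"
    using sm by (intro sets.finite_UN finite_sign_vecs) (auto intro!: borel_measurable_le)
  finally show B: "?B \<in> sets ?G" .
  have "ennreal (exp (- real N)) * emeasure ?G ?B = (\<integral>\<^sup>+\<omega>. ennreal (exp (- real N)) * indicator ?B \<omega> \<partial>?G)"
    using B by (subst nn_integral_cmult_indicator) auto
  also have "\<dots> \<le> (\<integral>\<^sup>+\<omega>. (\<Sum>\<sigma>\<in>sign_vecs N. ?E \<omega> \<sigma>) \<partial>?G)"
  proof (intro nn_integral_mono)
    fix \<omega> assume w: "\<omega> \<in> space ?G"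
    show "ennreal (exp (- real N)) * indicator ?B \<omega> \<le> (\<Sum>\<sigma>\<in>sign_vecs N. ?E \<omega> \<sigma>)"
    proof (cases "bad \<omega>")
      case True
      then obtain \<sigma> where \<sigma>: "\<sigma> \<in> sign_vecs N" "s \<omega> \<sigma> \<le> (real N)\<^sup>2 / 128" by (auto simp: bad_def s_def)
      have "128 * s \<omega> \<sigma> / real N \<le> real N"
        using \<sigma>(2) N by (simp add: pos_divide_le_eq power2_eq_square)
      then have "ennreal (exp (- real N)) \<le> ?E \<omega> \<sigma>" by (intro ennreal_leI) simp
      also have "\<dots> \<le> (\<Sum>\<sigma>\<in>sign_vecs N. ?E \<omega> \<sigma>)"
        using \<sigma>(1) by (intro member_le_sum finite_sign_vecs) auto
      finally show ?thesis using True w by simp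
    qed simp
  qed
  also have "\<dots> = (\<Sum>\<sigma>\<in>sign_vecs N. \<integral>\<^sup>+\<omega>. ?E \<omega> \<sigma> \<partial>?G)"
    using sm by (intro nn_integral_sum) auto
  also have "\<dots> \<le> (\<Sum>\<sigma>\<in>sign_vecs N. ennreal ((1 / 16) ^ N))"
    unfolding s_def by (intro sum_mono laplace_mat_act N)
  also have "\<dots> = ennreal (real (card (sign_vecs N)) * (1 / 16) ^ N)"
    by (simp add: ennreal_mult ennreal_of_nat_eq_real_of_nat)
  also have "\<dots> \<le> ennreal (2 ^ N * (1 / 16) ^ N)"
  proof -
    have "real (card (sign_vecs N)) \<le> real (2 ^ N)" using card_sign_vecs_le of_nat_mono by blast
    then show ?thesis by (intro ennreal_leI mult_right_mono) auto
  qed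
  finally have "ennreal (exp (- real N)) * ennreal (measure ?G ?B) \<le> ennreal (2 ^ N * (1 / 16) ^ N)"
    by (simp add: G.emeasure_eq_measure)
  then have "exp (- real N) * measure ?G ?B \<le> 2 ^ N * (1 / 16) ^ N"
    by (simp add: ennreal_mult[symmetric])
  then have "measure ?G ?B \<le> exp (real N) * (2 ^ N * (1 / 16) ^ N)"
    by (simp add: exp_minus field_simps)
  also have "\<dots> = (exp 1 / 8) ^ N"
    using exp_of_nat_mult[of N "1::real"] by (simp add: power_mult_distrib[symmetric] power_divide[symmetric])
  also have "\<dots> \<le> (1 / 2) ^ N"
    using exp_le by (intro power_mono) auto
  also have "\<dots> \<le> (1 / 2) ^ 1" using N by (intro power_decreasing) auto
  finally show "measure ?G ?B \<le> 1 / 2" by simp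
qed

text \<open>The power mean inequality; for finite exponents, from the tangent to the power \<open>r / 2\<close> at the mean square \<open>y\<close>: the
  linear terms cancel in the sum.\<close>

lemma lq_norm_ge_l2:
  assumes q: "2 \<le> q" and N: "0 < N" and s: "x\<^sup>2 \<le> (\<Sum>i<N. (v i)\<^sup>2) / real N" and x: "0 \<le> x"
  shows "real N powr (real_of_ereal (1 / q)) * x \<le> lq_norm q (Matrix.vec N v)"
proof (cases q)
  case (real r)
  have r: "2 \<le> r" using q real by simp
  define y where "y = (\<Sum>i<N. (v i)\<^sup>2) / real N"
  have y: "0 \<le> y" "x\<^sup>2 \<le> y"
    using s unfolding y_def by (auto intro!: divide_nonneg_nonneg sum_nonneg)
  have "(\<Sum>i<N. (v i)\<^sup>2 - y) = 0" using N by (simp add: sum_subtractf y_def)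
  then have "0 = (\<Sum>i<N. r / 2 * y powr (r / 2 - 1) * ((v i)\<^sup>2 - y))"
    by (simp only: sum_distrib_left[symmetric] mult_zero_right)
  also have "\<dots> \<le> (\<Sum>i<N. ((v i)\<^sup>2) powr (r / 2) - y powr (r / 2))"
    using r y by (intro sum_mono powr_above_tangent) auto
  also have "\<dots> = (\<Sum>i<N. \<bar>v i\<bar> powr r) - real N * y powr (r / 2)"
  proof -
    have "((v i)\<^sup>2) powr (r / 2) = \<bar>v i\<bar> powr r" for i
      using powr_powr[of "\<bar>v i\<bar>" 2 "r / 2"] by simp
    then show ?thesis by (simp add: sum_subtractf)
  qed
  finally have "real N * y powr (r / 2) \<le> (\<Sum>i<N. \<bar>v i\<bar> powr r)" by simp
  moreover have "x powr r \<le> y powr (r / 2)"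
  proof -
    have "x powr r = (x\<^sup>2) powr (r / 2)" using x powr_powr[of x 2 "r / 2"] by simp
    also have "\<dots> \<le> y powr (r / 2)" using r y by (intro powr_mono2) auto
    finally show ?thesis .
  qed
  ultimately have "real N * x powr r \<le> (\<Sum>i<N. \<bar>v i\<bar> powr r)"
    by (meson mult_left_mono of_nat_0_le_iff order_trans)
  then have "(real N * x powr r) powr (1 / r) \<le> (\<Sum>i<N. \<bar>v i\<bar> powr r) powr (1 / r)"
    using r by (intro powr_mono2) auto
  then show ?thesis
    using r x by (simp add: real lq_norm_vec_ereal real_of_ereal_one_divide powr_mult powr_powr)
next
  case PInf
  define M where "M = lq_norm \<infinity> (Matrix.vec N v)"
  have M: "0 \<le> M" by (simp add: M_def lq_norm_nonneg)
  have "\<bar>v i\<bar> \<le> M" if "i < N" for i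
    unfolding M_def lq_norm_vec_infinity[OF N] using that by (intro Max_ge) auto
  then have "(\<Sum>i<N. (v i)\<^sup>2) \<le> (\<Sum>i<N. M\<^sup>2)"
    using M by (intro sum_mono) (auto simp: abs_le_square_iff[symmetric])
  then have "(\<Sum>i<N. (v i)\<^sup>2) / real N \<le> M\<^sup>2" using N by (simp add: pos_divide_le_eq mult.commute)
  then have "x\<^sup>2 \<le> M\<^sup>2" using s by linarith
  then have "x \<le> M" using M by (rule power2_le_imp_le)
  then show ?thesis using N by (simp add: PInf M_def)
qed (use q in auto)

theorem expectation_disc_ge:
  assumes N: "0 < N" and q: "2 \<le> q"
  shows "real N powr (real_of_ereal (1 / q)) * (sqrt (real N) / sqrt 128) / 2
    \<le> prob_space.expectation (gaussian_entries N) (\<lambda>\<omega>. disc q (gaussian_mat N \<omega>))"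
proof -
  let ?G = "gaussian_entries N"
  interpret G: prob_space ?G by (rule prob_space_gaussian_entries)
  have q0: "0 \<le> q" using q by (rule order_trans[rotated]) simp
  define x where "x = sqrt (real N) / sqrt 128"
  define t where "t = real N powr (real_of_ereal (1 / q)) * x"
  have t0: "0 \<le> t" by (simp add: t_def x_def)
  define B where "B = {\<omega> \<in> space ?G. \<exists>\<sigma>\<in>sign_vecs N. (\<Sum>i<N. (mat_act N \<omega> \<sigma> i)\<^sup>2) \<le> (real N)\<^sup>2 / 128}"
  have B: "B \<in> sets ?G" "G.prob B \<le> 1 / 2" unfolding B_def using prob_some_signing_small[OF N] by auto
  have int: "integrable ?G (\<lambda>\<omega>. disc q (gaussian_mat N \<omega>))"
    by (rule G.square_integrable_imp_integrable[OF measurable_gaussian_entries[OF measurable_disc[OF N q0]]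
      square_integrable_disc[OF N q]])
  have low: "t \<le> disc q (gaussian_mat N \<omega>)" if w: "\<omega> \<in> space ?G - B" for \<omega>
  proof -
    have "disc q (gaussian_mat N \<omega>) \<in> (\<lambda>\<sigma>. lq_norm q (Matrix.vec N (mat_act N \<omega> \<sigma>))) ` sign_vecs N"
      unfolding disc_eq_Min using finite_sign_vecs sign_vecs_nonempty by (intro Min_in) auto
    then obtain \<sigma> where \<sigma>: "\<sigma> \<in> sign_vecs N"
      "disc q (gaussian_mat N \<omega>) = lq_norm q (Matrix.vec N (mat_act N \<omega> \<sigma>))" by auto
    have "(real N)\<^sup>2 / 128 < (\<Sum>i<N. (mat_act N \<omega> \<sigma> i)\<^sup>2)" using w \<sigma>(1) by (force simp: B_def)
    then have "x\<^sup>2 \<le> (\<Sum>i<N. (mat_act N \<omega> \<sigma> i)\<^sup>2) / real N"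
      using N by (simp add: x_def power_divide pos_le_divide_eq power2_eq_square)
    then show ?thesis unfolding t_def \<sigma>(2) by (intro lq_norm_ge_l2 q N) (auto simp: x_def)
  qed
  have "t / 2 \<le> t * G.prob (space ?G - B)"
  proof -
    have "t * (1 / 2) \<le> t * (1 - G.prob B)" using B t0 by (intro mult_left_mono) auto
    then show ?thesis using B by (simp add: G.prob_compl)
  qed
  also have "\<dots> = G.expectation (\<lambda>\<omega>. t * indicator (space ?G - B) \<omega>)"
    using B by (simp add: measure_def)
  also have "\<dots> \<le> G.expectation (\<lambda>\<omega>. disc q (gaussian_mat N \<omega>))"
  proof (intro integral_mono int)
    show "integrable ?G (\<lambda>\<omega>. t * indicator (space ?G - B) \<omega>)"
      using B by (intro integrable_mult_right integrable_real_indicator) (auto simp: G.emeasure_eq_measure)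
    show "t * indicator (space ?G - B) \<omega> \<le> disc q (gaussian_mat N \<omega>)" for \<omega>
      using low[of \<omega>] disc_nonneg[of q N \<omega>] by (auto simp: indicator_def)
  qed
  finally show ?thesis by (simp add: t_def x_def)
qed

section \<open>Ratio of mean and standard deviation\<close>

lemma std_normal_interval_pos:
  assumes "0 < \<epsilon>"
  shows "0 < measure std_normal_distribution {- \<epsilon>..\<epsilon>}"
proof -
  interpret S: real_distribution std_normal_distribution by (rule real_dist_normal_dist)
  have pos: "\<not> std_normal_density x \<le> 0" for x by (simp add: not_le normal_density_pos)
  have "emeasure std_normal_distribution {- \<epsilon>..\<epsilon>} \<noteq> 0"
  proof
    assume "emeasure std_normal_distribution {- \<epsilon>..\<epsilon>} = 0"
    then have "AE x in lborel. x \<notin> {- \<epsilon>..\<epsilon>}"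
      by (subst (asm) emeasure_density, simp, simp, subst (asm) nn_integral_0_iff_AE, simp)
        (auto simp: indicator_def ennreal_eq_0_iff pos elim!: eventually_mono split: if_splits)
    then have "emeasure lborel {- \<epsilon>..\<epsilon>} = 0"
      by (subst (asm) AE_iff_measurable[of "{- \<epsilon>..\<epsilon>}"]) auto
    then show False using assms by (simp add: ennreal_eq_0_iff)
  qed
  then show ?thesis by (simp add: S.emeasure_eq_measure zero_less_measure_iff)
qed

text \<open>Any one signing gives an upper bound; the factor \<open>N powr (1 / q)\<close> in the norm of a constant vector is
  bounded by \<open>N\<close>.\<close>

lemma disc_le_entries:
  assumes N: "0 < N" and q: "2 \<le> q" and e: "0 \<le> \<epsilon>" and w: "\<And>p. p \<in> {..<N} \<times> {..<N} \<Longrightarrow> \<bar>\<omega> p\<bar> \<le> \<epsilon>"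
  shows "disc q (gaussian_mat N \<omega>) \<le> real N * (real N * \<epsilon>)"
proof -
  obtain \<sigma> where s: "\<sigma> \<in> sign_vecs N" using sign_vecs_nonempty by auto
  let ?v = "mat_act N \<omega> \<sigma>"
  have v: "\<bar>?v i\<bar> \<le> real N * \<epsilon>" if "i < N" for i
  proof -
    have "\<bar>?v i\<bar> \<le> (\<Sum>j<N. \<bar>\<omega> (i, j) * \<sigma> $ j\<bar>)" unfolding mat_act_def by (rule sum_abs)
    also have "\<dots> \<le> (\<Sum>j<N. \<epsilon>)" using w that sign_vecs_abs[OF s] by (intro sum_mono) (auto simp: abs_mult)
    finally show ?thesis by simp
  qed
  have "disc q (gaussian_mat N \<omega>) \<le> lq_norm q (Matrix.vec N ?v)"
    unfolding disc_eq_Min using finite_sign_vecs s by (intro Min_le) auto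
  also have "\<dots> \<le> real N * (real N * \<epsilon>)"
  proof (cases q)
    case (real r)
    then have r: "2 \<le> r" using q by simp
    have "(\<Sum>i<N. \<bar>?v i\<bar> powr r) \<le> (\<Sum>i<N. (real N * \<epsilon>) powr r)"
      using v r by (intro sum_mono powr_mono2) auto
    also have "\<dots> = real N powr 1 * (real N * \<epsilon>) powr r" using N by simp
    also have "\<dots> \<le> real N powr r * (real N * \<epsilon>) powr r"
      using r N by (intro mult_right_mono powr_mono) auto
    also have "\<dots> = (real N * (real N * \<epsilon>)) powr r" using e by (simp add: powr_mult)
    finally have "(\<Sum>i<N. \<bar>?v i\<bar> powr r) powr (1 / r) \<le> ((real N * (real N * \<epsilon>)) powr r) powr (1 / r)"
      using r by (intro powr_mono2) (auto intro: sum_nonneg)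
    then show ?thesis using r e by (simp add: real lq_norm_vec_ereal powr_powr)
  next
    case PInf
    have "real N * \<epsilon> \<le> real N * (real N * \<epsilon>)"
      using N e mult_right_mono[of 1 "real N" "real N * \<epsilon>"] by simp
    moreover have "lq_norm q (Matrix.vec N ?v) \<le> real N * \<epsilon>"
      unfolding PInf lq_norm_vec_infinity[OF N] using N v by (intro Max.boundedI) auto
    ultimately show ?thesis by linarith
  qed (use q in auto)
  finally show ?thesis .
qed

text \<open>If the variance vanished, the discrepancy would be almost surely equal to its mean, which is
  positive. But with positive probability all entries are tiny, and then so is the discrepancy.\<close>

lemma variance_disc_pos:
  assumes N: "0 < N" and q: "2 \<le> q"
  shows "0 < prob_space.variance (gaussian_entries N) (\<lambda>\<omega>. disc q (gaussian_mat N \<omega>))"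
proof (rule ccontr)
  let ?G = "gaussian_entries N"
  let ?J = "{..<N} \<times> {..<N}"
  interpret G: prob_space ?G by (rule prob_space_gaussian_entries)
  have q0: "0 \<le> q" using q by (rule order_trans[rotated]) simp
  define X where "X = (\<lambda>\<omega>. disc q (gaussian_mat N \<omega>))"
  define \<mu> where "\<mu> = G.expectation X"
  have Xm: "X \<in> borel_measurable ?G"
    unfolding X_def by (intro measurable_gaussian_entries measurable_disc[OF N q0])
  have X2: "integrable ?G (\<lambda>\<omega>. (X \<omega>)\<^sup>2)" unfolding X_def by (rule square_integrable_disc[OF N q])
  have X1: "integrable ?G X" by (rule G.square_integrable_imp_integrable[OF Xm X2])
  have "0 < real N powr (real_of_ereal (1 / q)) * (sqrt (real N) / sqrt 128) / 2" using N by simp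
  then have \<mu>: "0 < \<mu>" using expectation_disc_ge[OF N q] by (simp add: \<mu>_def X_def)
  assume "\<not> 0 < G.variance (\<lambda>\<omega>. disc q (gaussian_mat N \<omega>))"
  then have "\<not> 0 < G.expectation (\<lambda>\<omega>. (X \<omega> - \<mu>)\<^sup>2)" by (simp only: X_def \<mu>_def not_False_eq_True)
  moreover have "0 \<le> G.expectation (\<lambda>\<omega>. (X \<omega> - \<mu>)\<^sup>2)" by simp
  ultimately have "G.expectation (\<lambda>\<omega>. (X \<omega> - \<mu>)\<^sup>2) = 0" by linarith
  moreover have "integrable ?G (\<lambda>\<omega>. (X \<omega> - \<mu>)\<^sup>2)"
    unfolding power2_diff using X1 X2 by auto
  ultimately have AE: "AE \<omega> in ?G. X \<omega> = \<mu>"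
    by (subst (asm) integral_nonneg_eq_0_iff_AE) auto
  define \<epsilon> where "\<epsilon> = \<mu> / (2 * (real N * real N))"
  have \<epsilon>: "0 < \<epsilon>" using \<mu> N by (simp add: \<epsilon>_def)
  let ?A = "PiE ?J (\<lambda>_. {- \<epsilon>..\<epsilon>})"
  have A: "?A \<in> sets ?G" unfolding gaussian_entries_def by (intro sets_PiM_I_finite) auto
  interpret P: product_prob_space "\<lambda>_. std_normal_distribution" ?J
    by (intro product_prob_spaceI) (auto intro: prob_space_normal_density)
  interpret P: finite_product_prob_space "\<lambda>_. std_normal_distribution" ?J
    by standard simp
  have "G.prob ?A = (\<Prod>p\<in>?J. measure std_normal_distribution {- \<epsilon>..\<epsilon>})"
    unfolding gaussian_entries_def by (intro P.prob_times) auto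
  also have "\<dots> > 0" using std_normal_interval_pos[OF \<epsilon>] by (intro prod_pos) auto
  finally have "0 < G.prob ?A" .
  moreover have "X \<omega> < \<mu>" if "\<omega> \<in> ?A" for \<omega>
  proof -
    have "\<bar>\<omega> p\<bar> \<le> \<epsilon>" if "p \<in> ?J" for p
    proof -
      have "\<omega> p \<in> {- \<epsilon>..\<epsilon>}" using PiE_mem[OF \<open>\<omega> \<in> ?A\<close> that] by simp
      then show ?thesis by (simp add: abs_if)
    qed
    then have "X \<omega> \<le> real N * (real N * \<epsilon>)"
      unfolding X_def using \<epsilon> by (intro disc_le_entries N q) auto
    also have "\<dots> = \<mu> / 2" using N by (simp add: \<epsilon>_def)
    finally show ?thesis using \<mu> by linarith
  qed
  then have "AE \<omega> in ?G. \<omega> \<notin> ?A" using AE by (auto elim!: eventually_mono)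
  then have "G.prob ?A = 0"
    using A by (subst (asm) G.prob_eq_0[symmetric]) auto
  ultimately show False by simp
qed

theorem theorem2p1:
  shows "\<exists>c::real. c > 0 \<and>
    (\<forall>\<^sub>F N in sequentially. \<forall>q::ereal. 2 \<le> q \<longrightarrow>
       prob_space.expectation (gaussian_entries N) (\<lambda>\<omega>. disc q (gaussian_mat N \<omega>))
         / sqrt (prob_space.variance (gaussian_entries N) (\<lambda>\<omega>. disc q (gaussian_mat N \<omega>)))
       \<ge> c * real N powr real_of_ereal (1 / q)
           * sqrt (1 + (1 / 2 - real_of_ereal (1 / q)) * ln (real N)))"
proof (intro exI conjI)
  let ?c = "1 / (2 * sqrt 128 * sqrt 712) :: real"
  show "?c > 0" by simp
  show "\<forall>\<^sub>F N in sequentially. \<forall>q::ereal. 2 \<le> q \<longrightarrow>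
       prob_space.expectation (gaussian_entries N) (\<lambda>\<omega>. disc q (gaussian_mat N \<omega>))
         / sqrt (prob_space.variance (gaussian_entries N) (\<lambda>\<omega>. disc q (gaussian_mat N \<omega>)))
       \<ge> ?c * real N powr real_of_ereal (1 / q)
           * sqrt (1 + (1 / 2 - real_of_ereal (1 / q)) * ln (real N))"
    using eventually_gt_at_top[of 0]
  proof eventually_elim
    case (elim N)
    show ?case
    proof (intro allI impI)
      fix q :: ereal assume q: "2 \<le> q"
      let ?G = "gaussian_entries N"
      define E where "E = prob_space.expectation ?G (\<lambda>\<omega>. disc q (gaussian_mat N \<omega>))"
      define V where "V = prob_space.variance ?G (\<lambda>\<omega>. disc q (gaussian_mat N \<omega>))"
      define b where "b = real N powr real_of_ereal (1 / q)"
      define l where "l = 1 + (1 / 2 - real_of_ereal (1 / q)) * ln (real N)"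
      have V: "0 < V" unfolding V_def by (rule variance_disc_pos[OF elim q])
      have b: "0 \<le> b" by (simp add: b_def)
      have "sqrt (l * V) \<le> sqrt (712 * real N)"
        using variance_disc_le[OF elim q] by (simp add: l_def V_def)
      then have "sqrt l * sqrt V \<le> sqrt 712 * sqrt (real N)" by (simp add: real_sqrt_mult)
      then have "?c * b * (sqrt l * sqrt V) \<le> ?c * b * (sqrt 712 * sqrt (real N))"
        using b by (intro mult_left_mono) auto
      also have "\<dots> = b * (sqrt (real N) / sqrt 128) / 2" by simp
      also have "\<dots> \<le> E" using expectation_disc_ge[OF elim q] by (simp add: b_def E_def)
      finally have "?c * b * sqrt l \<le> E / sqrt V"
        using V by (simp add: pos_le_divide_eq)
      then show "E / sqrt V \<ge> ?c * b * sqrt l" .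
    qed
  qed
qed

end
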